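(* Let $V$ be a complex $2\times 2$ matrix with $\det V=0$, and let $\nu(z)=\mathrm{Tr}_a\big(V_aT_a(z)\big)$, where $T_a(z)$ is the monodromy matrix of the spin chain with arbitrary positive (half)-integer spins $s_1,\dots,s_N$ and inhomogeneity parameters $\theta_1,\dots,\theta_N\in\mathbb{C}$ (defined in the context). Put $S=\sum_{i=1}^N 2s_i$, and let $\bar u=\{u_1,\dots,u_S\}$ be a set of arbitrary pairwise distinct complex parameters of cardinality $S$, and $z\in\mathbb{C}\setminus\bar u$. Then the following operator identity holds on $\bigotimes_{i=1}^N\mathbb{C}^{2s_i+1}$: $$\nu(z)\nu(\bar u)=\mathrm{Tr}(V)\left(F(z)\,g(z,\bar u)\,\nu(\bar u)+\sum_{i=1}^S g(u_i,z)\,F(u_i)\,g(u_i,\bar u_i)\,\nu(z)\,\nu(\bar u_i)\right),$$ where $\bar u_i=\bar u\setminus\{u_i\}$, $\nu(\bar u)=\prod_{j=1}^S\nu(u_j)$, $\nu(\bar u_i)=\prod_{j=1,\,j\ne i}^{S}\nu(u_j)$, and $$F(z)=\prod_{i=1}^N\prod_{k=0}^{2s_i}\frac{z-\theta_i+c\left(s_i-k+\frac12\right)}{c}.$$ The left-hand side involves the product of $S+1$ operators $\nu$, and each term of the right-hand side involves the product of $S$ operators $\nu$.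
   Context: Fix a nonzero constant $c\in\mathbb{C}$, an integer $N\ge1$, spins $s_1,\dots,s_N\in\{\tfrac12,1,\tfrac32,\dots\}$ and $\theta_1,\dots,\theta_N\in\mathbb{C}$. Spin representations: for each $i$, $S_i^{3},S_i^{+},S_i^{-}$ act on the $i$-th tensor factor $\mathbb{C}^{2s_i+1}$ as the irreducible spin-$s_i$ representation, with $[S^+,S^-]=2S^3$, $[S^3,S^\pm]=\pm S^\pm$; operators with different indices commute. Lax operator: $\mathcal{L}_{ai}(u)=\begin{pmatrix}\frac uc+\frac12+S_i^3 & S_i^-\\ S_i^+ & \frac uc+\frac12-S_i^3\end{pmatrix}_a$, a $2\times2$ matrix in the auxiliary space $a\cong\mathbb{C}^2$ with entries acting on the $i$-th factor. Monodromy matrix: $T_a(u)=\mathcal{L}_{a1}(u-\theta_1)\cdots\mathcal{L}_{aN}(u-\theta_N)=\begin{pmatrix}t_{11}(u)&t_{12}(u)\\t_{21}(u)&t_{22}(u)\end{pmatrix}$, with entries operators on $\bigotimes_{i=1}^N\mathbb{C}^{2s_i+1}$. For a $2\times 2$ matrix $V$, $\mathrm{Tr}_a(V_aT_a(z))=\sum_{k,l}V_{kl}t_{lk}(z)$; for fixed $V$ the operators $\nu(z)$, $\nu(w)$ commute for all $z,w$, so that products are unambiguous. Notation: $g(u,v)=\frac{c}{u-v}$, $g(z,\bar u)=\prod_{j}g(z,u_j)$, $g(u_i,\bar u_i)=\prod_{j\neq i}g(u_i,u_j)$ (empty products equal $1$). *)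

theory Defs
  imports Jordan_Normal_Form.VS_Connect
begin

text \<open>
  Conventions. Spins are given by the natural numbers \<open>d = 2s\<close>, so that \<open>s = d / 2\<close>
  and the representation space is \<open>\<complex>\<^bsup>d+1\<^esup>\<close>. Sites are numbered \<open>1, \<dots>, N\<close>, and a site
  dependent quantity is a function on \<open>nat\<close> of which only the values on \<open>{1..N}\<close> are used.
  The two basis vectors of the auxiliary space are numbered \<open>0, 1\<close>, so the operator usually
  denoted by \<open>t\<^sub>1\<^sub>2\<close> is the entry with indices \<open>0, 1\<close>.
\<close>

subsection \<open>Spin representations\<close>

definition spin_relations :: "complex mat \<Rightarrow> complex mat \<Rightarrow> complex mat \<Rightarrow> bool" where
  "spin_relations S3 Sp Sm \<longleftrightarrow>
     Sp * Sm - Sm * Sp = 2 \<cdot>\<^sub>m S3 \<and>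
     S3 * Sp - Sp * S3 = Sp \<and>
     S3 * Sm - Sm * S3 = - Sm"

definition irreducible_action :: "nat \<Rightarrow> complex mat set \<Rightarrow> bool" where
  "irreducible_action n A \<longleftrightarrow> 0 < n \<and>
     (\<forall>W. subspace class_ring W (module_vec TYPE(complex) n) \<longrightarrow>
          (\<forall>X\<in>A. \<forall>w\<in>W. X *\<^sub>v w \<in> W) \<longrightarrow>
          W = {0\<^sub>v n} \<or> W = carrier_vec n)"

definition spin_irrep :: "nat \<Rightarrow> complex mat \<Rightarrow> complex mat \<Rightarrow> complex mat \<Rightarrow> bool" where
  "spin_irrep d S3 Sp Sm \<longleftrightarrow>
     S3 \<in> carrier_mat (d + 1) (d + 1) \<and>
     Sp \<in> carrier_mat (d + 1) (d + 1) \<and>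
     Sm \<in> carrier_mat (d + 1) (d + 1) \<and>
     spin_relations S3 Sp Sm \<and>
     irreducible_action (d + 1) {S3, Sp, Sm}"

subsection \<open>Tensor products\<close>

definition kronecker :: "complex mat \<Rightarrow> complex mat \<Rightarrow> complex mat" where
  "kronecker A B = mat (dim_row A * dim_row B) (dim_col A * dim_col B)
     (\<lambda>(i, j). A $$ (i div dim_row B, j div dim_col B) * B $$ (i mod dim_row B, j mod dim_col B))"

definition kronecker_list :: "complex mat list \<Rightarrow> complex mat" where
  "kronecker_list As = foldr kronecker As (1\<^sub>m 1)"

definition space_dim :: "nat \<Rightarrow> (nat \<Rightarrow> nat) \<Rightarrow> nat" where
  "space_dim N d = (\<Prod>i = 1..N. d i + 1)"

text \<open>The operator \<open>1 \<otimes> \<dots> \<otimes> A \<otimes> \<dots> \<otimes> 1\<close> with \<open>A\<close> in the \<open>i\<close>-th tensor factor.\<close>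

definition site_op :: "nat \<Rightarrow> (nat \<Rightarrow> nat) \<Rightarrow> nat \<Rightarrow> complex mat \<Rightarrow> complex mat" where
  "site_op N d i A =
     kronecker_list (map (\<lambda>j. if j = i then A else 1\<^sub>m (d j + 1)) [1..<N + 1])"

text \<open>
  The product of operators on an \<open>n\<close>-dimensional space, in the order of the list. It is only
  applied to values of one transfer matrix, which commute, so the order is immaterial there.
\<close>

definition op_prod :: "nat \<Rightarrow> complex mat list \<Rightarrow> complex mat" where
  "op_prod n As = foldr (*) As (1\<^sub>m n)"

subsection \<open>Lax operator, monodromy matrix and transfer matrix\<close>

text \<open>
  A \<open>2 \<times> 2\<close> matrix over the operators on the quantum space is a function of two indices
  in \<open>{0, 1}\<close>; values at other indices are never used.
\<close>

type_synonym op_mat2 = "nat \<Rightarrow> nat \<Rightarrow> complex mat"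

definition op_mat2_one :: "nat \<Rightarrow> op_mat2" where
  "op_mat2_one n = (\<lambda>k l. if k = l then 1\<^sub>m n else 0\<^sub>m n n)"

definition op_mat2_mult :: "op_mat2 \<Rightarrow> op_mat2 \<Rightarrow> op_mat2" where
  "op_mat2_mult X Y = (\<lambda>k l. X k 0 * Y 0 l + X k 1 * Y 1 l)"

definition lax ::
  "complex \<Rightarrow> nat \<Rightarrow> (nat \<Rightarrow> nat) \<Rightarrow> (nat \<Rightarrow> complex mat) \<Rightarrow> (nat \<Rightarrow> complex mat) \<Rightarrow>
   (nat \<Rightarrow> complex mat) \<Rightarrow> nat \<Rightarrow> complex \<Rightarrow> op_mat2" where
  "lax c N d S3 Sp Sm i u = (\<lambda>k l.
     let a = (u / c + 1 / 2) \<cdot>\<^sub>m 1\<^sub>m (space_dim N d) in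
     if k = 0 \<and> l = 0 then a + site_op N d i (S3 i)
     else if k = 0 then site_op N d i (Sm i)
     else if l = 0 then site_op N d i (Sp i)
     else a - site_op N d i (S3 i))"

definition monodromy ::
  "complex \<Rightarrow> nat \<Rightarrow> (nat \<Rightarrow> nat) \<Rightarrow> (nat \<Rightarrow> complex) \<Rightarrow> (nat \<Rightarrow> complex mat) \<Rightarrow>
   (nat \<Rightarrow> complex mat) \<Rightarrow> (nat \<Rightarrow> complex mat) \<Rightarrow> complex \<Rightarrow> op_mat2" where
  "monodromy c N d \<theta> S3 Sp Sm u =
     foldr op_mat2_mult (map (\<lambda>i. lax c N d S3 Sp Sm i (u - \<theta> i)) [1..<N + 1])
       (op_mat2_one (space_dim N d))"

text \<open>\<open>Tr\<^sub>a (V\<^sub>a T\<^sub>a(z))\<close>, the partial trace over the auxiliary space.\<close>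

definition transfer_matrix ::
  "complex \<Rightarrow> nat \<Rightarrow> (nat \<Rightarrow> nat) \<Rightarrow> (nat \<Rightarrow> complex) \<Rightarrow> (nat \<Rightarrow> complex mat) \<Rightarrow>
   (nat \<Rightarrow> complex mat) \<Rightarrow> (nat \<Rightarrow> complex mat) \<Rightarrow> complex mat \<Rightarrow> complex \<Rightarrow> complex mat" where
  "transfer_matrix c N d \<theta> S3 Sp Sm V z =
     (let t = monodromy c N d \<theta> S3 Sp Sm z in
      V $$ (0, 0) \<cdot>\<^sub>m t 0 0 + V $$ (0, 1) \<cdot>\<^sub>m t 1 0 +
      V $$ (1, 0) \<cdot>\<^sub>m t 0 1 + V $$ (1, 1) \<cdot>\<^sub>m t 1 1)"

subsection \<open>Scalar functions\<close>

definition mat_trace :: "complex mat \<Rightarrow> complex" where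
  "mat_trace A = (\<Sum>i<dim_row A. A $$ (i, i))"

definition g :: "complex \<Rightarrow> complex \<Rightarrow> complex \<Rightarrow> complex" where
  "g c u v = c / (u - v)"

definition F :: "complex \<Rightarrow> nat \<Rightarrow> (nat \<Rightarrow> nat) \<Rightarrow> (nat \<Rightarrow> complex) \<Rightarrow> complex \<Rightarrow> complex" where
  "F c N d \<theta> z =
     (\<Prod>i = 1..N. \<Prod>k = 0..d i.
        (z - \<theta> i + c * (of_nat (d i) / 2 - of_nat k + 1 / 2)) / c)"

end

theory Submission
  imports Defs "Jordan_Normal_Form.Spectral_Radius"
begin

text \<open>
  If \<open>Tr V = \<tau> \<noteq> 0\<close>, a conjugation of the auxiliary space, absorbed into the spin operators, turns
  \<open>\<nu>\<close> into \<open>\<tau> A\<close>, where \<open>A = t\<^sub>1\<^sub>1\<close>. The identity is the statement that the divided difference of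
  the operator function \<open>F / \<nu>\<close> at the \<open>S + 1\<close> points \<open>z, u\<^sub>1, \<dots>, u\<^sub>S\<close> is the constant
  \<open>1 / (\<tau> c\<^sup>S)\<close>. So it suffices that \<open>F / A\<close> is a polynomial of degree \<open>S\<close> with leading
  coefficient \<open>c\<^bsup>-S\<^esup>\<close>, and that the values of \<open>A\<close> commute. The former is proved by induction on
  the number of sites, from \<open>A = (\<alpha> + S\<^sup>3) A' + S\<^sup>- C'\<close>: the inverse is expanded in powers of
  \<open>S\<^sup>-\<close>, the poles in the first factor are simple because the weights of a site are distinct, and
  the powers \<open>A'\<^sup>-\<^sup>1 (C' A'\<^sup>-\<^sup>1)\<^sup>k\<close> are, up to a scalar, iterated commutators of \<open>A'\<^sup>-\<^sup>1\<close> with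
  the total raising operator. The case \<open>Tr V = 0\<close> follows since both sides are polynomial in \<open>V\<close>.
\<close>

text \<open>The values of \<nu> need not be invertible, so no quotient is ever formed:
  \<open>A\<close> enters through a factor \<open>Q\<close> with A(x) Q(x) = F(x), and the divided
  difference of \<open>Q\<close> is multiplied by all values of \<nu> at once. The obstacle is the
  degree of \<open>Q\<close>. In the series for the inverse of (\<alpha> + S3) A' + S^- C', the k-th
  term carries k + 1 inverses of each of the two factors, hence apparent poles of order k + 1. The
  way out is one observation used twice. If a X is a scalar, [a, J] = b and [b, J] = 0, then the
  term with k + 1 inverses of a is, up to sign and a factorial, the k-fold commutator of X with J,
  and this has no larger degree than X. For the new site J is S^-, for the remaining chain J is the
  total raising operator. Since commutators of scalars vanish, only k = 0 contributes to the leading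
  coefficient. The factors of \<open>F\<close> at a site are \<alpha> + m, with m running over the
  weights of that site; irreducibility enters as the statement that the product of all m - S3 is
  zero.\<close>

section \<open>Lagrange interpolation\<close>

text \<open>The Lagrange interpolant \<open>p\<close> and the monomial of degree \<open>k\<close>
  agree at D + 1 nodes and have degree at most D, so they coincide; the claim compares their
  coefficients of degree D.\<close>

lemma divided_difference_power:
  fixes w :: "'i \<Rightarrow> 'a::field"
  assumes fin: "finite I" and inj: "inj_on w I" and card: "card I = Suc D" and k: "k \<le> D"
  shows "(\<Sum>i\<in>I. (\<Prod>j\<in>I - {i}. 1 / (w i - w j)) * w i ^ k) = (if k = D then 1 else 0)"
proof -
  define r where "r i = (\<Prod>j\<in>I - {i}. 1 / (w i - w j)) * w i ^ k" for i
  define e where "e i = (\<Prod>j\<in>I - {i}. [:- w j, 1:])" for i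
  define p where "p = (\<Sum>i\<in>I. Polynomial.smult (r i) (e i))"
  have deg_e: "degree (e i) = D" if "i \<in> I" for i
    unfolding e_def using that fin card by (subst degree_prod_sum_eq) auto
  have lead_e: "coeff (e i) D = 1" if "i \<in> I" for i
  proof -
    have "lead_coeff (e i) = 1"
      unfolding e_def lead_coeff_prod by simp
    then show ?thesis using deg_e[OF that] by simp
  qed
  have deg_p: "degree p \<le> D"
    unfolding p_def by (rule degree_sum_le[OF fin]) (metis deg_e degree_smult_le)
  have poly_e: "poly (e i) (w l) = (if l = i then (\<Prod>j\<in>I - {i}. w i - w j) else 0)"
    if "i \<in> I" "l \<in> I" for i l
    using that fin by (auto simp: e_def poly_prod)
  have poly_p: "poly p (w l) = w l ^ k" if l: "l \<in> I" for l
  proof -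
    have nz: "(\<Prod>j\<in>I - {l}. w l - w j) \<noteq> 0"
      using fin inj l by (auto simp: inj_on_def)
    have "poly p (w l) = (\<Sum>i\<in>I. if l = i then r i * (\<Prod>j\<in>I - {i}. w i - w j) else 0)"
      unfolding p_def poly_sum by (intro sum.cong) (auto simp: poly_e l)
    also have "\<dots> = r l * (\<Prod>j\<in>I - {l}. w l - w j)"
      using fin l by simp
    also have "\<dots> = w l ^ k"
      using nz by (simp add: r_def prod_dividef)
    finally show ?thesis .
  qed
  have "p = monom 1 k"
  proof (rule poly_eqI_degree[where A = "w ` I"])
    have "card (w ` I) = Suc D" using inj card by (simp add: card_image)
    then show "card (w ` I) > degree p" "card (w ` I) > degree (monom (1::'a) k)"
      using deg_p k degree_monom_le[of "1::'a" k] by auto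
  qed (auto simp: poly_p poly_monom)
  then have "coeff p D = (if k = D then 1 else 0)" by simp
  moreover have "coeff p D = (\<Sum>i\<in>I. r i)"
    unfolding p_def coeff_sum by (intro sum.cong) (auto simp: lead_e)
  ultimately show ?thesis by (simp add: r_def)
qed

text \<open>An abstract algebra frees the core of the argument from all dimension side conditions:
  operators at different sites are commuting elements of one ring, and scalars are central.\<close>

locale complex_algebra = Vector_Spaces.vector_space scale
  for scale :: "complex \<Rightarrow> 'a::ring_1 \<Rightarrow> 'a" (infixr "*\<^sub>C" 75) +
  assumes scale_mult_left [simp]: "(r *\<^sub>C x) * y = r *\<^sub>C (x * y)"
    and scale_mult_right [simp]: "x * (r *\<^sub>C y) = r *\<^sub>C (x * y)"
begin

subsection \<open>Polynomial functions with coefficients in a noncommutative algebra\<close>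

text \<open>\<open>D\<close> only bounds the degree, and \<open>L\<close> is the coefficient of
  degree \<open>D\<close>, possibly zero, so sums need no case distinction when leading terms
  cancel. The variable is a scalar and commutes with the coefficients.\<close>

definition polyfn :: "nat \<Rightarrow> (complex \<Rightarrow> 'a) \<Rightarrow> 'a \<Rightarrow> bool" where
  "polyfn D f L \<longleftrightarrow> (\<exists>q. (\<forall>x. f x = (\<Sum>k\<le>D. x ^ k *\<^sub>C q k)) \<and> q D = L)"

lemma polyfn_const: "polyfn 0 (\<lambda>_. a) a"
  unfolding polyfn_def by (rule exI[of _ "\<lambda>_. a"]) simp

lemma polyfn_id: "polyfn 1 (\<lambda>x. x *\<^sub>C a) a"
  unfolding polyfn_def by (rule exI[of _ "\<lambda>k. if k = 1 then a else 0"]) simp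

lemma polyfn_add: "polyfn D f L \<Longrightarrow> polyfn D h M \<Longrightarrow> polyfn D (\<lambda>x. f x + h x) (L + M)"
proof -
  assume "polyfn D f L" "polyfn D h M"
  then obtain p q where "\<forall>x. f x = (\<Sum>k\<le>D. x ^ k *\<^sub>C p k)" "p D = L"
    "\<forall>x. h x = (\<Sum>k\<le>D. x ^ k *\<^sub>C q k)" "q D = M" unfolding polyfn_def by blast
  then show ?thesis unfolding polyfn_def
    by (intro exI[of _ "\<lambda>k. p k + q k"]) (simp add: scale_right_distrib sum.distrib)
qed

lemma polyfn_raise: "polyfn D f L \<Longrightarrow> D < E \<Longrightarrow> polyfn E f 0"
proof -
  assume "polyfn D f L" and DE: "D < E"
  then obtain p where p: "\<forall>x. f x = (\<Sum>k\<le>D. x ^ k *\<^sub>C p k)" unfolding polyfn_def by blast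
  have "f x = (\<Sum>k\<le>E. x ^ k *\<^sub>C (if k \<le> D then p k else 0))" for x
  proof -
    have "(\<Sum>k\<le>E. x ^ k *\<^sub>C (if k \<le> D then p k else 0)) = (\<Sum>k\<le>D. x ^ k *\<^sub>C p k)"
      using DE by (intro sum.mono_neutral_cong_right) auto
    then show ?thesis using p by simp
  qed
  then show ?thesis unfolding polyfn_def using DE
    by (intro exI[of _ "\<lambda>k. if k \<le> D then p k else 0"]) auto
qed

lemma polyfn_sum:
  assumes "finite I" "\<And>i. i \<in> I \<Longrightarrow> polyfn D (f i) (L i)"
  shows "polyfn D (\<lambda>x. \<Sum>i\<in>I. f i x) (\<Sum>i\<in>I. L i)"
  using assms
proof (induction I rule: finite_induct)
  case empty
  have "polyfn D (\<lambda>_. 0) 0" unfolding polyfn_def by (intro exI[of _ "\<lambda>_. 0"]) simp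
  then show ?case by simp
next
  case (insert i I)
  then have "polyfn D (\<lambda>x. f i x + (\<Sum>i\<in>I. f i x)) (L i + (\<Sum>i\<in>I. L i))"
    by (intro polyfn_add) auto
  then show ?case using insert.hyps by simp
qed

lemma polyfn_mult_coeff: "polyfn D f L \<Longrightarrow> polyfn (D + e) (\<lambda>x. f x * (x ^ e *\<^sub>C a)) (L * a)"
proof -
  assume "polyfn D f L"
  then obtain p where p: "\<forall>x. f x = (\<Sum>k\<le>D. x ^ k *\<^sub>C p k)" "p D = L"
    unfolding polyfn_def by blast
  have "f x * (x ^ e *\<^sub>C a) = (\<Sum>k\<le>D + e. x ^ k *\<^sub>C (if e \<le> k then p (k - e) * a else 0))" for x
  proof -
    have "(\<Sum>k\<le>D + e. x ^ k *\<^sub>C (if e \<le> k then p (k - e) * a else 0))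
        = (\<Sum>k\<in>{e..D + e}. x ^ k *\<^sub>C (p (k - e) * a))"
      by (intro sum.mono_neutral_cong_right) auto
    also have "\<dots> = (\<Sum>k\<le>D. x ^ (k + e) *\<^sub>C (p k * a))"
      by (rule sum.reindex_bij_witness[of _ "\<lambda>k. k + e" "\<lambda>k. k - e"]) auto
    finally show ?thesis
      using p by (simp add: sum_distrib_right power_add scale_sum_right mult.commute)
  qed
  then show ?thesis unfolding polyfn_def using p
    by (intro exI[of _ "\<lambda>k. if e \<le> k then p (k - e) * a else 0"]) auto
qed

lemma polyfn_mult:
  assumes f: "polyfn D f L" and h: "polyfn E h M"
  shows "polyfn (D + E) (\<lambda>x. f x * h x) (L * M)"
proof -
  from h obtain q where q: "\<forall>x. h x = (\<Sum>k\<le>E. x ^ k *\<^sub>C q k)" "q E = M"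
    unfolding polyfn_def by blast
  \<comment> \<open>Only the top monomial of \<open>h\<close> reaches degree D + E; the lower ones
    are raised to this bound with leading coefficient 0.\<close>
  have "polyfn (D + E) (\<lambda>x. f x * (x ^ k *\<^sub>C q k)) (if k = E then L * M else 0)" if "k \<le> E" for k
    using polyfn_mult_coeff[OF f, of k "q k"] q that
    by (cases "k = E") (auto intro: polyfn_raise)
  then have "polyfn (D + E) (\<lambda>x. \<Sum>k\<le>E. f x * (x ^ k *\<^sub>C q k)) (\<Sum>k\<le>E. if k = E then L * M else 0)"
    by (intro polyfn_sum) auto
  then show ?thesis using q by (simp add: sum_distrib_left)
qed

lemma polyfn_mult_const:
  assumes "polyfn D f L"
  shows "polyfn D (\<lambda>x. f x * a) (L * a)" "polyfn D (\<lambda>x. a * f x) (a * L)"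
  using polyfn_mult[OF assms polyfn_const[of a]] polyfn_mult[OF polyfn_const[of a] assms] by simp_all

lemma polyfn_scale: "polyfn D f L \<Longrightarrow> polyfn D (\<lambda>x. r *\<^sub>C f x) (r *\<^sub>C L)"
  using polyfn_mult_const(2)[of D f L "r *\<^sub>C 1"] by simp

lemma polyfn_diff: "polyfn D f L \<Longrightarrow> polyfn D h M \<Longrightarrow> polyfn D (\<lambda>x. f x - h x) (L - M)"
  using polyfn_add[of D f L "\<lambda>x. (- 1) *\<^sub>C h x" "(- 1) *\<^sub>C M"] polyfn_scale[of D h M "- 1"] by simp

text \<open>By linearity in the coefficients this reduces to scalar powers: those below D are
  annihilated and the D-th one gives 1.\<close>

lemma divided_difference:
  assumes f: "polyfn D f L" and fin: "finite I" and inj: "inj_on w I" and card: "card I = Suc D"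
  shows "(\<Sum>i\<in>I. (\<Prod>j\<in>I - {i}. 1 / (w i - w j)) *\<^sub>C f (w i)) = L"
proof -
  from f obtain q where q: "\<forall>x. f x = (\<Sum>k\<le>D. x ^ k *\<^sub>C q k)" "q D = L"
    unfolding polyfn_def by blast
  define r where "r i = (\<Prod>j\<in>I - {i}. 1 / (w i - w j))" for i
  have "(\<Sum>i\<in>I. r i *\<^sub>C f (w i)) = (\<Sum>k\<le>D. \<Sum>i\<in>I. (r i * w i ^ k) *\<^sub>C q k)"
    using q by (simp add: scale_sum_right) (rule sum.swap)
  also have "\<dots> = (\<Sum>k\<le>D. (if k = D then 1 else 0) *\<^sub>C q k)"
    using divided_difference_power[OF fin inj card]
    by (intro sum.cong) (auto simp: r_def scale_sum_left[symmetric])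
  also have "\<dots> = (\<Sum>k\<le>D. if k = D then q k else 0)"
    by (intro sum.cong) auto
  finally show ?thesis using q by (simp add: r_def)
qed

definition is_polyfn :: "(complex \<Rightarrow> 'a) \<Rightarrow> bool" where
  "is_polyfn f \<longleftrightarrow> (\<exists>D L. polyfn D f L)"

lemma is_polyfn_mult: "is_polyfn f \<Longrightarrow> is_polyfn h \<Longrightarrow> is_polyfn (\<lambda>x. f x * h x)"
  unfolding is_polyfn_def by (blast intro: polyfn_mult)

lemma is_polyfn_const: "is_polyfn (\<lambda>_. a)"
  unfolding is_polyfn_def by (blast intro: polyfn_const)

lemma is_polyfn_id: "is_polyfn (\<lambda>x. x *\<^sub>C a)"
  unfolding is_polyfn_def by (blast intro: polyfn_id)

lemma is_polyfn_add: "is_polyfn f \<Longrightarrow> is_polyfn h \<Longrightarrow> is_polyfn (\<lambda>x. f x + h x)"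
proof -
  assume "is_polyfn f" "is_polyfn h"
  then obtain D L E M where "polyfn D f L" "polyfn E h M" unfolding is_polyfn_def by blast
  then have "polyfn (Suc (D + E)) f 0" "polyfn (Suc (D + E)) h 0" by (auto intro: polyfn_raise)
  then show ?thesis unfolding is_polyfn_def by (blast intro: polyfn_add)
qed

lemma is_polyfn_scale: "is_polyfn f \<Longrightarrow> is_polyfn (\<lambda>x. r *\<^sub>C f x)"
  unfolding is_polyfn_def by (blast intro: polyfn_scale)

lemma is_polyfn_diff: "is_polyfn f \<Longrightarrow> is_polyfn h \<Longrightarrow> is_polyfn (\<lambda>x. f x - h x)"
  using is_polyfn_add[of f "\<lambda>x. (- 1) *\<^sub>C h x"] is_polyfn_scale[of h "- 1"] by simp

lemma is_polyfn_sum: "finite I \<Longrightarrow> (\<And>i. i \<in> I \<Longrightarrow> is_polyfn (f i)) \<Longrightarrow> is_polyfn (\<lambda>x. \<Sum>i\<in>I. f i x)"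
  by (induction I rule: finite_induct) (auto intro: is_polyfn_const is_polyfn_add)

lemma is_polyfn_prod_list:
  "(\<And>j. j \<in> set js \<Longrightarrow> is_polyfn (f j)) \<Longrightarrow> is_polyfn (\<lambda>x. prod_list (map (\<lambda>j. f j x) js))"
  by (induction js) (auto intro: is_polyfn_const is_polyfn_mult)

text \<open>Density of \<open>\<complex> - {0}\<close>, in the form of a divided difference over \<open>0, 1, \<dots>, D + 1\<close>.\<close>

lemma is_polyfn_zero:
  assumes f: "is_polyfn f" and zero: "\<And>x. x \<noteq> 0 \<Longrightarrow> f x = 0"
  shows "f 0 = 0"
proof -
  from f obtain D L where "polyfn D f L" unfolding is_polyfn_def by blast
  \<comment> \<open>Raising the bound makes the leading coefficient 0 and calls for D + 2 nodes, of
    which only the node 0 can contribute.\<close>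
  then have "polyfn (Suc D) f 0" by (rule polyfn_raise) simp
  then have "(\<Sum>i\<le>Suc D. (\<Prod>j\<in>{..Suc D} - {i}. 1 / (complex_of_nat i - of_nat j)) *\<^sub>C f (of_nat i)) = 0"
    by (rule divided_difference) (auto simp: inj_on_def)
  also have "(\<Sum>i\<le>Suc D. (\<Prod>j\<in>{..Suc D} - {i}. 1 / (complex_of_nat i - of_nat j)) *\<^sub>C f (of_nat i))
    = (\<Sum>i\<in>{0}. (\<Prod>j\<in>{..Suc D} - {i}. 1 / (complex_of_nat i - of_nat j)) *\<^sub>C f (of_nat i))"
    by (rule sum.mono_neutral_right) (auto simp: zero)
  finally have "(\<Prod>j\<in>{..Suc D} - {0}. 1 / (0 - complex_of_nat j)) *\<^sub>C f 0 = 0" by simp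
  moreover have "(\<Prod>j\<in>{..Suc D} - {0}. 1 / (0 - complex_of_nat j)) \<noteq> 0" by simp
  ultimately show ?thesis by (metis scale_eq_0_iff)
qed

end

definition weight :: "nat \<Rightarrow> nat \<Rightarrow> complex" where
  "weight n k = of_nat n / 2 - of_nat k"

context complex_algebra
begin

subsection \<open>Inner derivations\<close>

text \<open>The sign is opposite to the usual adjoint action, so that the total raising operator
  maps the entry \<open>T is x 0 0\<close> to \<open>T is x 1 0\<close> without a sign.\<close>

definition ad :: "'a \<Rightarrow> 'a \<Rightarrow> 'a" where
  "ad J X = X * J - J * X"

lemma ad_simps [simp]:
  "ad J (X + Y) = ad J X + ad J Y"
  "ad J (X - Y) = ad J X - ad J Y"
  "ad J (- X) = - ad J X"
  "ad J (r *\<^sub>C X) = r *\<^sub>C ad J X"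
  "ad J 0 = 0"
  "ad J 1 = 0"
  by (simp_all add: ad_def algebra_simps)

lemma ad_mult: "ad J (X * Y) = ad J X * Y + X * ad J Y"
  by (simp add: ad_def algebra_simps)

lemma ad_add_left: "ad (J + K) X = ad J X + ad K X"
  by (simp add: ad_def algebra_simps)

lemma ad_commuting: "X * J = J * X \<Longrightarrow> ad J X = 0"
  by (simp add: ad_def)

lemma ad_pow_zero [simp]: "(ad J ^^ k) 0 = 0"
  by (induction k) auto

lemma ad_pow_add: "(ad J ^^ k) (X + Y) = (ad J ^^ k) X + (ad J ^^ k) Y"
  by (induction k) auto

lemma ad_pow_scale: "(ad J ^^ k) (r *\<^sub>C X) = r *\<^sub>C (ad J ^^ k) X"
  by (induction k) auto

text \<open>Leibniz rule: of p + q + 1 derivations, more than p fall on \<open>X\<close> or more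
  than q on \<open>Y\<close>. Induction on p + q removes one derivation at a time and avoids
  binomial coefficients.\<close>

lemma ad_pow_mult:
  assumes "(ad J ^^ Suc p) X = 0" "(ad J ^^ Suc q) Y = 0"
  shows "(ad J ^^ Suc (p + q)) (X * Y) = 0"
  using assms
proof (induction "p + q" arbitrary: p q X Y)
  case 0
  then show ?case by (simp add: ad_mult)
next
  case (Suc n)
  have "(ad J ^^ (p + q)) (ad J X * Y) = 0"
  proof (cases p)
    case 0
    then show ?thesis using Suc.prems by simp
  next
    case (Suc p')
    then show ?thesis
      using Suc.hyps(1)[of p' q "ad J X" Y] Suc.hyps(2) Suc.prems by (simp add: funpow_swap1)
  qed
  moreover have "(ad J ^^ (p + q)) (X * ad J Y) = 0"
  proof (cases q)
    case 0
    then show ?thesis using Suc.prems by simp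
  next
    case (Suc q')
    then show ?thesis
      using Suc.hyps(1)[of p q' X "ad J Y"] Suc.hyps(2) Suc.prems by (simp add: funpow_swap1)
  qed
  ultimately show ?case
    by (simp add: funpow_swap1 ad_mult ad_pow_add)
qed

lemma polyfn_ad_pow: "polyfn D f L \<Longrightarrow> polyfn D (\<lambda>x. (ad J ^^ k) (f x)) ((ad J ^^ k) L)"
  by (induction k) (auto simp: ad_def intro: polyfn_diff polyfn_mult_const)

text \<open>Formally the coefficient of t^k in exp(-tJ) X exp(tJ).\<close>

definition dpow :: "'a \<Rightarrow> nat \<Rightarrow> 'a \<Rightarrow> 'a" where
  "dpow J k X = (1 / fact k) *\<^sub>C (ad J ^^ k) X"

lemma dpow_0 [simp]: "dpow J 0 X = X"
  by (simp add: dpow_def)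

lemma dpow_scalar: "0 < k \<Longrightarrow> dpow J k (r *\<^sub>C 1) = 0"
  by (cases k) (simp_all add: dpow_def funpow_swap1)

lemma polyfn_dpow: "polyfn D f L \<Longrightarrow> polyfn D (\<lambda>x. dpow J k (f x)) (dpow J k L)"
  unfolding dpow_def by (intro polyfn_scale polyfn_ad_pow)

lemma ad_commute:
  assumes "Y * J = J * Y" "Y * X = X * Y"
  shows "Y * ad J X = ad J X * Y"
proof -
  have "Y * (X * J) = X * J * Y" "Y * (J * X) = J * X * Y"
    using assms by (metis mult.assoc)+
  then show ?thesis by (simp add: ad_def algebra_simps)
qed

lemma dpow_commute:
  assumes "Y * J = J * Y" "Y * X = X * Y"
  shows "Y * dpow J k X = dpow J k X * Y"
proof -
  have "Y * (ad J ^^ k) X = (ad J ^^ k) X * Y"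
    by (induction k) (auto intro: ad_commute assms)
  then show ?thesis by (simp add: dpow_def)
qed

text \<open>Formally, conjugation by exp(tJ) turns a into a + t b and fixes the scalar a X, so the
  Taylor coefficients of the conjugated X satisfy a X_{k+1} + b X_k = 0. They are the terms of the
  geometric series for r (a + t b)^{-1}, obtained without inverting a.\<close>

lemma mult_dpow_Suc:
  assumes ab: "ad J a = b" "ad J b = 0" and aX: "a * X = r *\<^sub>C 1"
  shows "a * dpow J (Suc k) X = - (b * dpow J k X)"
proof -
  have eq: "a * (ad J ^^ Suc k) X = - (of_nat (Suc k) *\<^sub>C (b * (ad J ^^ k) X))" for k
  proof (induction k)
    case 0
    have "ad J (a * X) = 0" by (simp add: aX)
    then show ?case using ab by (simp add: ad_mult eq_neg_iff_add_eq_0 add.commute)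
  next
    case (Suc k)
    let ?Y = "(ad J ^^ Suc k) X"
    \<comment> \<open>The derivation of the left side yields a further \<open>b * ?Y\<close> besides
      \<open>a * ad J ?Y\<close>; moved to the right, it raises the factor from k + 1 to k +
      2.\<close>
    have "ad J (a * ?Y) = - (of_nat (Suc k) *\<^sub>C (b * ?Y))"
      unfolding Suc.IH using ab by (simp add: ad_mult)
    then have "b * ?Y + a * ad J ?Y = - (of_nat (Suc k) *\<^sub>C (b * ?Y))"
      using ab by (simp only: ad_mult)
    moreover have "of_nat (Suc (Suc k)) *\<^sub>C (b * ?Y) = b * ?Y + of_nat (Suc k) *\<^sub>C (b * ?Y)"
      by (simp only: of_nat_Suc[of "Suc k"] scale_left_distrib scale_one)
    moreover have "a * ad J ?Y = b * ?Y + a * ad J ?Y - b * ?Y" by (simp only: add_diff_cancel_left')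
    ultimately have "a * ad J ?Y = - (of_nat (Suc (Suc k)) *\<^sub>C (b * ?Y))"
      by (simp only: minus_add_distrib) (simp only: diff_conv_add_uminus add.commute)
    then show ?case by simp
  qed
  have "a * dpow J (Suc k) X = (1 / fact (Suc k)) *\<^sub>C (a * (ad J ^^ Suc k) X)"
    by (simp add: dpow_def)
  also have "\<dots> = - ((of_nat (Suc k) / fact (Suc k)) *\<^sub>C (b * (ad J ^^ k) X))"
    unfolding eq by simp
  also have "of_nat (Suc k) / fact (Suc k) = (1 / fact k :: complex)"
    by (simp add: field_simps del: of_nat_Suc)
  finally show ?thesis by (simp add: dpow_def)
qed

text \<open>The sum telescopes: the \<open>h * A\<close> part of the term k + 1 is minus the
  \<open>e * C\<close> part of the term k. What remains is the scalar from k = 0 and the last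
  \<open>e * C\<close> part.\<close>

lemma bidiagonal_quotient:
  assumes u: "h * u 0 = f *\<^sub>C 1" "\<And>k. h * u (Suc k) = e * u k"
    and q: "A * q 0 = \<phi> *\<^sub>C 1" "\<And>k. A * q (Suc k) = - (C * q k)"
    and comm: "\<And>k. A * u k = u k * A" "\<And>k. C * u k = u k * C"
  shows "(h * A + e * C) * (\<Sum>k\<le>K. u k * q k) = (f * \<phi>) *\<^sub>C 1 + e * u K * (C * q K)"
proof -
  have step: "(h * A + e * C) * (u k * q k) = h * u k * (A * q k) + e * u k * (C * q k)" for k
    using comm[of k] by (simp add: distrib_right mult.assoc) (metis mult.assoc)
  show ?thesis
  proof (induction K)
    case 0
    then show ?case by (simp add: step u q)
  next
    case (Suc K)
    have "(h * A + e * C) * (\<Sum>k\<le>Suc K. u k * q k)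
        = (f * \<phi>) *\<^sub>C 1 + e * u K * (C * q K) + (h * A + e * C) * (u (Suc K) * q (Suc K))"
      using Suc by (simp add: distrib_left)
    then show ?case by (simp add: step u q)
  qed
qed

subsection \<open>A single spin\<close>

text \<open>At k = n + 1 this is, up to sign, the characteristic polynomial of the third spin
  component evaluated at \<open>S\<close>; its vanishing is the form in which irreducibility of a
  site is used.\<close>

primrec weight_prod :: "nat \<Rightarrow> 'a \<Rightarrow> nat \<Rightarrow> 'a" where
  "weight_prod n S 0 = 1"
| "weight_prod n S (Suc k) = weight_prod n S k * (weight n k *\<^sub>C 1 - S)"

text \<open>The quotient of \<open>\<Prod>\<^sub>l (a + m\<^sub>l) - \<Prod>\<^sub>l (m\<^sub>l - S)\<close> by \<open>a + S\<close>, where \<open>m\<^sub>l\<close> are the weights.\<close>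

primrec weight_quot :: "nat \<Rightarrow> 'a \<Rightarrow> nat \<Rightarrow> complex \<Rightarrow> 'a" where
  "weight_quot n S 0 a = 0"
| "weight_quot n S (Suc k) a = (a + weight n k) *\<^sub>C weight_quot n S k a + weight_prod n S k"

lemma weight_prod_commute: "Y * S = S * Y \<Longrightarrow> Y * weight_prod n S k = weight_prod n S k * Y"
proof (induction k)
  case (Suc k)
  have "Y * (weight n k *\<^sub>C 1 - S) = (weight n k *\<^sub>C 1 - S) * Y"
    using Suc.prems by (simp add: algebra_simps)
  with Suc show ?case by simp (metis mult.assoc)
qed simp

lemma weight_quot_commute: "Y * S = S * Y \<Longrightarrow> Y * weight_quot n S k a = weight_quot n S k a * Y"
  by (induction k) (auto simp: weight_prod_commute algebra_simps)

text \<open>The induction step rests on (a + S) - (a + m) = -(m - S) for the new weight m. Once all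
  weights are included and \<open>weight_prod\<close> vanishes, \<open>weight_quot\<close> is the
  inverse of a + S up to a scalar.\<close>

lemma mult_weight_quot:
  "(a *\<^sub>C 1 + S) * weight_quot n S k a = (\<Prod>l<k. a + weight n l) *\<^sub>C 1 - weight_prod n S k"
proof (induction k)
  case (Suc k)
  let ?R = "weight_prod n S k"
  have SR: "S * ?R = ?R * S" by (rule weight_prod_commute) simp
  have "(a *\<^sub>C 1 + S) * weight_quot n S (Suc k) a
    = (a + weight n k) *\<^sub>C ((a *\<^sub>C 1 + S) * weight_quot n S k a) + (a *\<^sub>C 1 + S) * ?R"
    by (simp add: distrib_left)
  also have "\<dots> = (\<Prod>l<Suc k. a + weight n l) *\<^sub>C 1 - weight_prod n S (Suc k)"
    unfolding Suc by (simp add: algebra_simps SR)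
  finally show ?case .
qed simp

lemma ad_pow_weight_prod:
  assumes "ad J (ad J S) = 0"
  shows "(ad J ^^ Suc k) (weight_prod n S k) = 0"
proof (induction k)
  case (Suc k)
  have "(ad J ^^ Suc 1) (weight n k *\<^sub>C 1 - S) = 0" using assms by simp
  from ad_pow_mult[OF Suc this] show ?case by simp
qed simp

text \<open>\<open>weight_quot\<close> has degree below k in \<open>S\<close>, and each factor
  \<open>S\<close> survives only one commutator. This truncates the geometric series at a
  site.\<close>

lemma ad_pow_weight_quot:
  assumes "ad J (ad J S) = 0"
  shows "(ad J ^^ k) (weight_quot n S k a) = 0"
proof (induction k)
  case (Suc k)
  then have "(ad J ^^ Suc k) ((a + weight n k) *\<^sub>C weight_quot n S k a) = 0"
    by (subst ad_pow_scale) simp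
  then show ?case using ad_pow_weight_prod[OF assms, of k n]
    by (simp only: weight_quot.simps ad_pow_add) simp
qed simp

text \<open>The first factor only produces the constant 1, so k + 1 factors give degree k. Each
  later factor contributes 1 / c to the leading coefficient, while the added
  \<open>weight_prod\<close> is constant in x.\<close>

lemma polyfn_weight_quot:
  assumes a: "\<And>x. a x = (x - t) / c + 1 / 2"
  shows "polyfn k (\<lambda>x. weight_quot n S (Suc k) (a x)) ((1 / c ^ k) *\<^sub>C 1)"
proof (induction k)
  case 0
  show ?case using polyfn_const[of 1] by simp
next
  case (Suc k)
  let ?b = "1 / 2 - t / c + weight n (Suc k)"
  have eq: "(a x + weight n (Suc k)) *\<^sub>C X = (x *\<^sub>C ((1 / c) *\<^sub>C 1) + ?b *\<^sub>C 1) * X" for x X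
  proof -
    have "a x + weight n (Suc k) = x / c + ?b" by (simp add: a diff_divide_distrib)
    then show ?thesis by (simp only: scale_left_distrib distrib_right) simp
  qed
  have "polyfn 1 (\<lambda>x. x *\<^sub>C ((1 / c) *\<^sub>C 1) + ?b *\<^sub>C 1) ((1 / c) *\<^sub>C 1 + 0)"
    by (intro polyfn_add polyfn_id polyfn_raise[OF polyfn_const]) simp
  from polyfn_mult[OF this Suc]
  have "polyfn (Suc k) (\<lambda>x. (a x + weight n (Suc k)) *\<^sub>C weight_quot n S (Suc k) (a x)
      + weight_prod n S (Suc k)) ((1 / c ^ Suc k) *\<^sub>C 1 + 0)"
    by (intro polyfn_add polyfn_raise[OF polyfn_const]) (simp_all add: eq mult.commute[of c])
  then show ?case by (simp only: weight_quot.simps(2)[of n S "Suc k"] add_0_right)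
qed

end

context complex_algebra
begin

subsection \<open>The abstract monodromy matrix\<close>

definition lax_op :: "complex \<Rightarrow> (nat \<Rightarrow> complex) \<Rightarrow> (nat \<Rightarrow> nat \<Rightarrow> nat \<Rightarrow> 'a) \<Rightarrow> nat \<Rightarrow> complex \<Rightarrow> nat \<Rightarrow> nat \<Rightarrow> 'a" where
  "lax_op c \<theta> s i x k l = (if k = l then ((x - \<theta> i) / c + 1 / 2) *\<^sub>C 1 else 0) + s i k l"

primrec mono_op :: "complex \<Rightarrow> (nat \<Rightarrow> complex) \<Rightarrow> (nat \<Rightarrow> nat \<Rightarrow> nat \<Rightarrow> 'a) \<Rightarrow> nat list \<Rightarrow> complex \<Rightarrow> nat \<Rightarrow> nat \<Rightarrow> 'a" where
  "mono_op c \<theta> s [] x k l = (if k = l then 1 else 0)"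
| "mono_op c \<theta> s (i # is) x k l = (\<Sum>p<2. lax_op c \<theta> s i x k p * mono_op c \<theta> s is x p l)"

end

text \<open>
  The entries \<open>s i 0 0\<close>, \<open>s i 0 1\<close>, \<open>s i 1 0\<close>, \<open>s i 1 1\<close> stand for \<open>S\<^sup>3\<close>, \<open>S\<^sup>-\<close>, \<open>S\<^sup>+\<close>, \<open>- S\<^sup>3\<close>
  at the site \<open>i\<close>.
\<close>

locale spin_chain = complex_algebra scale
  for scale :: "complex \<Rightarrow> 'a::ring_1 \<Rightarrow> 'a" (infixr "*\<^sub>C" 75) +
  fixes c :: complex and \<theta> :: "nat \<Rightarrow> complex" and s :: "nat \<Rightarrow> nat \<Rightarrow> nat \<Rightarrow> 'a"
    and I :: "nat set" and d :: "nat \<Rightarrow> nat"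
  assumes c: "c \<noteq> 0"
    and s_rel: "\<And>i. i \<in> I \<Longrightarrow> s i 1 0 * s i 0 1 - s i 0 1 * s i 1 0 = s i 0 0 + s i 0 0"
      "\<And>i. i \<in> I \<Longrightarrow> s i 0 0 * s i 1 0 - s i 1 0 * s i 0 0 = s i 1 0"
      "\<And>i. i \<in> I \<Longrightarrow> s i 0 0 * s i 0 1 - s i 0 1 * s i 0 0 = - s i 0 1"
      "\<And>i. i \<in> I \<Longrightarrow> s i 1 1 = - s i 0 0"
    and s_comm: "\<And>i j k l p q. i \<in> I \<Longrightarrow> j \<in> I \<Longrightarrow> i \<noteq> j \<Longrightarrow>
      k < 2 \<Longrightarrow> l < 2 \<Longrightarrow> p < 2 \<Longrightarrow> q < 2 \<Longrightarrow> s i k l * s j p q = s j p q * s i k l"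
    and s_weight: "\<And>i. i \<in> I \<Longrightarrow> weight_prod (d i) (s i 0 0) (Suc (d i)) = 0"
begin

abbreviation "L \<equiv> lax_op c \<theta> s"
abbreviation "T \<equiv> mono_op c \<theta> s"

section \<open>Exchange relations of the monodromy entries\<close>

lemma commute_lax:
  "Y * s i k l = s i k l * Y \<Longrightarrow> Y * L i x k l = L i x k l * Y"
  by (simp add: lax_op_def algebra_simps)

lemma commute_mono:
  assumes "\<And>i k l. i \<in> set is \<Longrightarrow> k < 2 \<Longrightarrow> l < 2 \<Longrightarrow> Y * s i k l = s i k l * Y" "k < 2" "l < 2"
  shows "Y * T is x k l = T is x k l * Y"
  using assms
proof (induction "is" arbitrary: k)
  case (Cons i js)
  have "Y * (L i x k p * T js x p l) = L i x k p * T js x p l * Y" if "p < 2" for p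
  proof -
    have "Y * L i x k p = L i x k p * Y" using Cons.prems that by (intro commute_lax) auto
    moreover have "Y * T js x p l = T js x p l * Y" using Cons.prems that by (intro Cons.IH) auto
    ultimately show ?thesis by (metis mult.assoc)
  qed
  then show ?case by (simp add: sum_distrib_left sum_distrib_right)
qed simp

lemma lax_mono_commute:
  assumes "set (i # is) \<subseteq> I" "i \<notin> set is" "k < 2" "l < 2" "p < 2" "q < 2"
  shows "L i y p q * T is x k l = T is x k l * L i y p q"
proof -
  have "s i p q * T is x k l = T is x k l * s i p q"
    using assms by (intro commute_mono s_comm) auto
  from commute_lax[OF this[symmetric]] show ?thesis by simp
qed

text \<open>The entries differ from the spin operators by scalars, so their commutator does not
  depend on u and v. Multiplied by u - v = c (a - b), it matches the difference of the two exchanged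
  products, in which only the terms linear in the spins with coefficient a - b survive.\<close>

lemma lax_rtt:
  assumes i: "i \<in> I" and "k < 2" "l < 2" "p < 2" "q < 2"
  shows "(u - v) *\<^sub>C (L i u k p * L i v l q) + c *\<^sub>C (L i u l p * L i v k q)
    = (u - v) *\<^sub>C (L i v l q * L i u k p) + c *\<^sub>C (L i v l p * L i u k q)"
proof -
  define a where "a = (u - \<theta> i) / c + 1 / 2"
  define b where "b = (v - \<theta> i) / c + 1 / 2"
  have uv: "u - v = c * (a - b)" using c by (simp add: a_def b_def field_simps)
  have ab: "L i u k l = (if k = l then a *\<^sub>C 1 else 0) + s i k l"
    "L i v k l = (if k = l then b *\<^sub>C 1 else 0) + s i k l" for k l
    by (simp_all add: lax_op_def a_def b_def)
  \<comment> \<open>The spin relations in the uniform shape of the gl(2) relations.\<close>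
  have comm: "s i k p * s i l q - s i l q * s i k p
      = (if k = q then s i l p else 0) - (if p = l then s i k q else 0)"
    if "k < 2" "l < 2" "p < 2" "q < 2" for k l p q
  proof -
    have "k = 0 \<or> k = 1" "l = 0 \<or> l = 1" "p = 0 \<or> p = 1" "q = 0 \<or> q = 1" using that by auto
    then show ?thesis
      using s_rel[OF i] by (elim disjE) (simp_all add: algebra_simps)
  qed
  have "L i u k p * L i v l q - L i v l q * L i u k p = s i k p * s i l q - s i l q * s i k p"
    by (simp add: ab algebra_simps)
  then have "(u - v) *\<^sub>C (L i u k p * L i v l q - L i v l q * L i u k p)
      = (u - v) *\<^sub>C ((if k = q then s i l p else 0) - (if p = l then s i k q else 0))"
    using comm assms by simp
  also have "\<dots> = c *\<^sub>C (L i v l p * L i u k q - L i u l p * L i v k q)"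
    unfolding uv by (simp add: ab algebra_simps)
  finally show ?thesis by (simp add: algebra_simps)
qed

text \<open>The RTT relation applied to the highest weight vector of both auxiliary spaces.\<close>

lemma mono_rtt:
  assumes "set is \<subseteq> I" "distinct is" "k < 2" "l < 2"
  shows "(u - v) *\<^sub>C (T is u k 0 * T is v l 0) + c *\<^sub>C (T is u l 0 * T is v k 0)
    = (u - v + c) *\<^sub>C (T is v l 0 * T is u k 0)"
  using assms
proof (induction "is" arbitrary: k l)
  case Nil
  then show ?case by (auto simp: scale_left_distrib)
next
  case (Cons i js)
  have x: "T js u p 0 * L i v l q = L i v l q * T js u p 0"
    and y: "T js v p 0 * L i u l q = L i u l q * T js v p 0" if "p < 2" "q < 2" "l < 2" for p q l
    using lax_mono_commute[of i js] Cons.prems that by auto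
  have prod: "(L i u k p * T js u p 0) * (L i v l q * T js v q 0)
      = L i u k p * L i v l q * (T js u p 0 * T js v q 0)"
    "(L i v l q * T js v q 0) * (L i u k p * T js u p 0)
      = L i v l q * L i u k p * (T js v q 0 * T js u p 0)"
    if "k < 2" "p < 2" "l < 2" "q < 2" for k l p q
  proof -
    have "(L i u k p * T js u p 0) * (L i v l q * T js v q 0)
        = L i u k p * (T js u p 0 * L i v l q) * T js v q 0" by (simp only: mult.assoc)
    then show "(L i u k p * T js u p 0) * (L i v l q * T js v q 0)
        = L i u k p * L i v l q * (T js u p 0 * T js v q 0)"
      using that by (simp only: x mult.assoc)
    have "(L i v l q * T js v q 0) * (L i u k p * T js u p 0)
        = L i v l q * (T js v q 0 * L i u k p) * T js u p 0" by (simp only: mult.assoc)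
    then show "(L i v l q * T js v q 0) * (L i u k p * T js u p 0)
        = L i v l q * L i u k p * (T js v q 0 * T js u p 0)"
      using that by (simp only: y mult.assoc)
  qed
  have kl: "k < 2" "l < 2" using Cons.prems by auto
  have IH: "(u - v) *\<^sub>C (T js u p 0 * T js v q 0) + c *\<^sub>C (T js u q 0 * T js v p 0)
    = (u - v + c) *\<^sub>C (T js v q 0 * T js u p 0)" if "p < 2" "q < 2" for p q
    using Cons.IH[of p q] Cons.prems that by simp
  let ?XY = "\<lambda>p q. T js u p 0 * T js v q 0"
  have TT: "T (i # js) u k 0 * T (i # js) v l 0 = (\<Sum>p<2. \<Sum>q<2. L i u k p * L i v l q * ?XY p q)"
    if "k < 2" "l < 2" for k l
    unfolding mono_op.simps sum_product using that by (intro sum.cong refl prod) auto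
  have "(u - v) *\<^sub>C (T (i # js) u k 0 * T (i # js) v l 0) + c *\<^sub>C (T (i # js) u l 0 * T (i # js) v k 0)
    = (\<Sum>p<2. \<Sum>q<2. ((u - v) *\<^sub>C (L i u k p * L i v l q) + c *\<^sub>C (L i u l p * L i v k q)) * ?XY p q)"
    unfolding TT[OF kl] TT[OF kl(2,1)] scale_sum_right sum.distrib[symmetric]
    by (simp only: distrib_right scale_mult_left)
  also have "\<dots> = (\<Sum>p<2. \<Sum>q<2. ((u - v) *\<^sub>C (L i v l q * L i u k p) + c *\<^sub>C (L i v l p * L i u k q)) * ?XY p q)"
    using kl Cons.prems by (intro sum.cong refl arg_cong2[where f = "(*)"] lax_rtt) auto
  also have "\<dots> = (\<Sum>p<2. \<Sum>q<2. (L i v l q * L i u k p) * ((u - v) *\<^sub>C ?XY p q))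
      + (\<Sum>p<2. \<Sum>q<2. (L i v l p * L i u k q) * (c *\<^sub>C ?XY p q))"
    by (simp only: distrib_right sum.distrib scale_mult_left scale_mult_right)
  \<comment> \<open>Renaming p and q moves the exchange of indices from the Lax entries to the
    remaining chain, where the induction hypothesis applies.\<close>
  also have "(\<Sum>p<2. \<Sum>q<2. (L i v l p * L i u k q) * (c *\<^sub>C ?XY p q))
      = (\<Sum>p<2. \<Sum>q<2. (L i v l q * L i u k p) * (c *\<^sub>C ?XY q p))"
    by (rule sum.swap)
  also have "(\<Sum>p<2. \<Sum>q<2. (L i v l q * L i u k p) * ((u - v) *\<^sub>C ?XY p q)) + \<dots>
      = (\<Sum>p<2. \<Sum>q<2. (L i v l q * L i u k p) * ((u - v) *\<^sub>C ?XY p q + c *\<^sub>C ?XY q p))"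
    by (simp only: distrib_left sum.distrib)
  also have "\<dots> = (\<Sum>p<2. \<Sum>q<2. (L i v l q * L i u k p) * ((u - v + c) *\<^sub>C (T js v q 0 * T js u p 0)))"
    by (intro sum.cong refl) (simp only: IH lessThan_iff)
  also have "\<dots> = (u - v + c) *\<^sub>C (\<Sum>p<2. \<Sum>q<2. (L i v l q * T js v q 0) * (L i u k p * T js u p 0))"
    unfolding scale_sum_right using kl by (intro sum.cong refl) (simp only: prod lessThan_iff scale_mult_right)
  also have "(\<Sum>p<2. \<Sum>q<2. (L i v l q * T js v q 0) * (L i u k p * T js u p 0))
      = T (i # js) v l 0 * T (i # js) u k 0"
    unfolding mono_op.simps sum_product by (rule sum.swap)
  finally show ?case .
qed

text \<open>At k = l = 0 the exchange relation is the claim multiplied by u - v + c. If this factor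
  vanishes, the relation with u and v interchanged has the factor 2c instead.\<close>

lemma mono_commute:
  assumes "set is \<subseteq> I" "distinct is"
  shows "T is u 0 0 * T is v 0 0 = T is v 0 0 * T is u 0 0"
proof -
  have *: "u - v + c = 0 \<or> T is u 0 0 * T is v 0 0 = T is v 0 0 * T is u 0 0" for u v
    using mono_rtt[OF assms, of 0 0 u v]
    by (simp flip: scale_left_distrib) blast
  show ?thesis
  proof (cases "u - v + c = 0")
    case True
    then have "v - u + c \<noteq> 0" using c by (auto simp: algebra_simps add_eq_0_iff)
    then show ?thesis using *[of v u] by simp
  qed (use *[of u v] in simp)
qed

section \<open>The polynomial quotient for the upper left entry\<close>

definition raising :: "nat list \<Rightarrow> 'a" where
  "raising is = (\<Sum>j\<leftarrow>is. s j 1 0)"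

lemma commute_raising:
  "(\<And>i. i \<in> set is \<Longrightarrow> Y * s i 1 0 = s i 1 0 * Y) \<Longrightarrow> Y * raising is = raising is * Y"
  by (induction "is") (auto simp: raising_def algebra_simps)

lemma mono_Cons:
  "T (i # is) x k l = L i x k 0 * T is x 0 l + L i x k 1 * T is x 1 l"
  by (simp add: numeral_2_eq_2)

text \<open>sl(2) invariance: the monodromy matrix commutes with the raising operator of the chain
  plus that of the auxiliary space. Hence the commutator with the chain part only moves auxiliary
  indices, and on column 0 only the row index moves.\<close>

lemma ad_raising:
  assumes "set is \<subseteq> I" "distinct is"
  shows "ad (raising is) (T is x 0 0) = T is x 1 0 \<and> ad (raising is) (T is x 1 0) = 0"
  using assms
proof (induction "is")
  case Nil
  show ?case by (simp add: raising_def)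
next
  case (Cons i js)
  let ?Y = "s i 1 0"
  have i: "i \<in> I" and js: "set js \<subseteq> I" "i \<notin> set js" "distinct js" using Cons.prems by auto
  have split: "ad (raising (i # js)) X = ad ?Y X + ad (raising js) X" for X
    by (simp add: raising_def ad_add_left)
  have T: "ad ?Y (T js x p 0) = 0" if "p < 2" for p
    by (rule ad_commuting, rule sym, rule commute_mono) (use Cons.prems that in \<open>auto intro!: s_comm\<close>)
  have L: "ad (raising js) (L i x k l) = 0" if "k < 2" "l < 2" for k l
    by (rule ad_commuting, rule sym, rule commute_lax, rule sym, rule commute_raising)
      (use Cons.prems that in \<open>auto intro!: s_comm\<close>)
  have LY: "ad ?Y (L i x 0 0) = L i x 1 0" "ad ?Y (L i x 0 1) = L i x 1 1 - L i x 0 0"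
    "ad ?Y (L i x 1 0) = 0" "ad ?Y (L i x 1 1) = - L i x 1 0"
    using s_rel[OF i] by (simp_all add: lax_op_def ad_def algebra_simps)
  have IH: "ad (raising js) (T js x 0 0) = T js x 1 0" "ad (raising js) (T js x 1 0) = 0"
    using Cons.IH js by auto
  show ?case
    unfolding mono_Cons split by (simp add: ad_mult T L LY IH algebra_simps del: One_nat_def)
qed

definition eigen_prod :: "nat list \<Rightarrow> complex \<Rightarrow> complex" where
  "eigen_prod is x = (\<Prod>i\<leftarrow>is. \<Prod>k<Suc (d i). (x - \<theta> i) / c + 1 / 2 + weight (d i) k)"

text \<open>
  The quotient for \<open>i # is\<close> is the expansion of \<open>((\<alpha> + S\<^sup>3) A + S\<^sup>- C)\<^sup>-\<^sup>1\<close> in powers of \<open>C\<close>; all powers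
  of \<open>C\<close> are absorbed by the derivation \<open>ad (raising is)\<close>, which maps \<open>A\<close> to \<open>C\<close>.
\<close>

theorem mono_quotient:
  assumes "set is \<subseteq> I" "distinct is"
  shows "\<exists>Q. (\<forall>x. T is x 0 0 * Q x = eigen_prod is x *\<^sub>C 1) \<and>
    polyfn (sum_list (map d is)) Q ((1 / c ^ sum_list (map d is)) *\<^sub>C 1) \<and>
    (\<forall>Y. (\<forall>i\<in>set is. \<forall>k<2. \<forall>l<2. Y * s i k l = s i k l * Y) \<longrightarrow> (\<forall>x. Y * Q x = Q x * Y))"
  using assms
proof (induction "is")
  case Nil
  show ?case using polyfn_const[of 1] by (intro exI[of _ "\<lambda>_. 1"]) (simp add: eigen_prod_def)
next
  case (Cons i js)
  have i: "i \<in> I" and js: "set js \<subseteq> I" "i \<notin> set js" "distinct js" using Cons.prems by auto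
  define E where "E = sum_list (map d js)"
  from Cons.IH js obtain R where R: "\<And>x. T js x 0 0 * R x = eigen_prod js x *\<^sub>C 1"
    "polyfn E R ((1 / c ^ E) *\<^sub>C 1)"
    "\<And>Y x. (\<forall>i\<in>set js. \<forall>k<2. \<forall>l<2. Y * s i k l = s i k l * Y) \<Longrightarrow> Y * R x = R x * Y"
    unfolding E_def by metis
  define a where "a x = (x - \<theta> i) / c + 1 / 2" for x
  define S where "S = s i 0 0"
  define e where "e = s i 0 1"
  \<comment> \<open>\<open>U\<close> inverts a + \<open>S\<close> up to the scalar \<open>f\<close>;
    \<open>u\<close> and \<open>q\<close> are the geometric series terms of the site and of the
    remaining chain. The signs in \<open>uS\<close> and \<open>qS\<close> differ because
    \<open>ad e S = - e\<close>, whereas the raising operator maps the upper left entry to plus the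
    lower left one.\<close>
  define U where "U x = weight_quot (d i) S (Suc (d i)) (a x)" for x
  define u where "u x k = dpow e k (U x)" for x k
  define q where "q x k = dpow (raising js) k (R x)" for x k
  define Q where "Q x = (\<Sum>k\<le>d i. u x k * q x k)" for x
  define f where "f x = (\<Prod>k<Suc (d i). a x + weight (d i) k)" for x
  have Se: "ad e S = - e" "ad e e = 0"
    using s_rel(3)[OF i] by (simp_all add: ad_def S_def e_def)
  have u0: "(a x *\<^sub>C 1 + S) * u x 0 = f x *\<^sub>C 1" for x
    using s_weight[OF i] mult_weight_quot[of "a x" S "d i" "Suc (d i)"]
    by (simp add: u_def U_def S_def f_def del: weight_quot.simps weight_prod.simps prod.lessThan_Suc)
  have uS: "(a x *\<^sub>C 1 + S) * u x (Suc k) = e * u x k" for x k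
    using mult_dpow_Suc[of e "a x *\<^sub>C 1 + S" "- e" "U x" "f x" k] u0[of x] Se by (simp add: u_def)
  have ud: "u x (Suc (d i)) = 0" for x
    using ad_pow_weight_quot[of e S "Suc (d i)" "d i" "a x"] Se
    by (simp add: u_def U_def dpow_def del: weight_quot.simps funpow.simps)
  have q0: "T js x 0 0 * q x 0 = eigen_prod js x *\<^sub>C 1" for x
    by (simp add: q_def R)
  have qS: "T js x 0 0 * q x (Suc k) = - (T js x 1 0 * q x k)" for x k
    unfolding q_def using ad_raising[OF js(1,3)] R(1) by (intro mult_dpow_Suc) auto
  have comm_u: "Y * u x k = u x k * Y" if "Y * S = S * Y" "Y * e = e * Y" for Y x k
    unfolding u_def U_def by (intro dpow_commute weight_quot_commute that)
  have comm_q: "Y * q x k = q x k * Y"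
    if "\<forall>i\<in>set js. \<forall>k<2. \<forall>l<2. Y * s i k l = s i k l * Y" for Y x k
    unfolding q_def using that by (intro dpow_commute R(3) commute_raising) auto
  have T_site: "T js x p 0 * s i k l = s i k l * T js x p 0" if "p < 2" "k < 2" "l < 2" for x p k l
    using Cons.prems that by (intro commute_mono[symmetric] s_comm) auto
  have "T (i # js) x 0 0 * Q x = eigen_prod (i # js) x *\<^sub>C 1" for x
  proof -
    have "((a x *\<^sub>C 1 + S) * T js x 0 0 + e * T js x 1 0) * Q x
        = (f x * eigen_prod js x) *\<^sub>C 1 + e * u x (d i) * (T js x 1 0 * q x (d i))"
      unfolding Q_def using u0 uS q0 qS
      by (rule bidiagonal_quotient) (intro comm_u; simp add: S_def e_def T_site)+
    \<comment> \<open>The remainder of the truncated series: by \<open>uS\<close> it is a multiple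
      of the term with index d + 1, which is zero.\<close>
    moreover have "e * u x (d i) = 0"
      using uS[of x "d i"] ud by simp
    moreover have "T (i # js) x 0 0 = (a x *\<^sub>C 1 + S) * T js x 0 0 + e * T js x 1 0"
      unfolding mono_Cons by (simp add: lax_op_def a_def S_def e_def)
    ultimately show ?thesis
      by (simp add: eigen_prod_def f_def a_def)
  qed
  moreover have "polyfn (d i + E) Q ((1 / c ^ (d i + E)) *\<^sub>C 1)"
  proof -
    have "polyfn (d i) U ((1 / c ^ d i) *\<^sub>C 1)"
      unfolding U_def by (rule polyfn_weight_quot[where t = "\<theta> i"]) (simp add: a_def)
    then have "polyfn (d i + E) Q
      (\<Sum>k\<le>d i. dpow e k ((1 / c ^ d i) *\<^sub>C 1) * dpow (raising js) k ((1 / c ^ E) *\<^sub>C 1))"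
      unfolding Q_def u_def q_def using R(2) by (intro polyfn_sum polyfn_mult polyfn_dpow) auto
    \<comment> \<open>The leading coefficients of \<open>U\<close> and \<open>R\<close> are scalars,
      so all their proper commutators vanish.\<close>
    moreover have "(\<Sum>k\<le>d i. dpow e k ((1 / c ^ d i) *\<^sub>C 1) * dpow (raising js) k ((1 / c ^ E) *\<^sub>C 1))
      = (\<Sum>k\<in>{0}. dpow e k ((1 / c ^ d i) *\<^sub>C 1) * dpow (raising js) k ((1 / c ^ E) *\<^sub>C 1))"
      by (rule sum.mono_neutral_right) (auto simp: dpow_scalar)
    ultimately show ?thesis by (simp add: power_add mult.commute)
  qed
  moreover have "Y * Q x = Q x * Y"
    if Y: "\<forall>j\<in>set (i # js). \<forall>k<2. \<forall>l<2. Y * s j k l = s j k l * Y" for Y x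
  proof -
    have "Y * (u x k * q x k) = u x k * q x k * Y" for k
      using comm_u[of Y x k] comm_q[of Y x k] Y unfolding S_def e_def
      by simp (metis mult.assoc)
    then show ?thesis by (simp add: Q_def sum_distrib_left sum_distrib_right)
  qed
  ultimately show ?case
    unfolding E_def by (intro exI[of _ Q]) (simp del: mono_op.simps)
qed

end

section \<open>From the polynomial quotient to the operator identity\<close>

context complex_algebra
begin

lemma prod_list_commute:
  "(\<And>j. j \<in> set js \<Longrightarrow> Y * f j = f j * Y) \<Longrightarrow> Y * prod_list (map f js) = prod_list (map f js) * Y"
proof (induction js)
  case (Cons j js)
  then have "Y * f j = f j * Y" "Y * prod_list (map f js) = prod_list (map f js) * Y" by auto
  then show ?case by simp (metis mult.assoc)
qed simp

lemma prod_list_remove: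
  assumes comm: "\<And>i j. f i * f j = f j * f i" and "distinct js" "i \<in> set js"
  shows "prod_list (map f (filter (\<lambda>j. j \<noteq> i) js)) * f i = prod_list (map f js)"
  using assms(2,3)
proof (induction js)
  case (Cons j js)
  show ?case
  proof (cases "j = i")
    case True
    then have "filter (\<lambda>j. j \<noteq> i) js = js" using Cons.prems by (auto simp: filter_id_conv)
    with True show ?thesis using prod_list_commute[of js "f i" f] comm by simp
  next
    case False
    with Cons show ?thesis by (simp add: mult.assoc)
  qed
qed simp

text \<open>Left side minus right side of the identity. \<tau> and \<nu> are independent arguments,
  so that both can be varied polynomially in a parameter when the trace is zero.\<close>

definition transfer_defect ::
  "complex \<Rightarrow> (complex \<Rightarrow> complex) \<Rightarrow> nat \<Rightarrow> (nat \<Rightarrow> complex) \<Rightarrow> complex \<Rightarrow> complex \<Rightarrow> (complex \<Rightarrow> 'a) \<Rightarrow> 'a" where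
  "transfer_defect c \<phi> S u z \<tau> \<nu> =
    \<nu> z * prod_list (map (\<lambda>j. \<nu> (u j)) [1..<S + 1]) -
    \<tau> *\<^sub>C ((\<phi> z * (\<Prod>j = 1..S. g c z (u j))) *\<^sub>C prod_list (map (\<lambda>j. \<nu> (u j)) [1..<S + 1])
      + (\<Sum>i\<in>{1..S}. (g c (u i) z * \<phi> (u i) * (\<Prod>j\<in>{1..S} - {i}. g c (u i) (u j))) *\<^sub>C
          (\<nu> z * prod_list (map (\<lambda>j. \<nu> (u j)) (filter (\<lambda>j. j \<noteq> i) [1..<S + 1])))))"

text \<open>After division by all the \<open>\<nu>\<close>, this is the divided difference of \<open>Q = \<phi> / \<nu>\<close> at \<open>z, u\<^sub>1, \<dots>, u\<^sub>S\<close>.\<close>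

lemma transfer_defect_quotient:
  assumes comm: "\<And>x y. \<nu> x * \<nu> y = \<nu> y * \<nu> x"
    and quot: "\<And>x. \<nu> x * Q x = \<phi> x *\<^sub>C 1"
    and poly: "polyfn S Q ((1 / (\<tau> * c ^ S)) *\<^sub>C 1)"
    and nz: "\<tau> \<noteq> 0" "c \<noteq> 0"
    and inj: "inj_on u {1..S}" and z: "z \<notin> u ` {1..S}"
  shows "transfer_defect c \<phi> S u z \<tau> \<nu> = 0"
proof -
  \<comment> \<open>The index 0 is free and is given to z, which makes the S + 1 nodes one
    family.\<close>
  define w where "w i = (if i = 0 then z else u i)" for i
  define r where "r i = (\<Prod>j\<in>{0..S} - {i}. 1 / (w i - w j))" for i
  define P where "P = prod_list (map (\<lambda>j. \<nu> (u j)) [1..<S + 1])"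
  define Pi where "Pi i = prod_list (map (\<lambda>j. \<nu> (u j)) (filter (\<lambda>j. j \<noteq> i) [1..<S + 1]))" for i
  have inj_w: "inj_on w {0..S}"
  proof -
    have "inj_on w {1..S}"
    proof (rule inj_onI)
      fix i j assume ij: "i \<in> {1..S}" "j \<in> {1..S}" and "w i = w j"
      then have "u i = u j" by (simp add: w_def)
      then show "i = j" using ij by (rule inj_onD[OF inj])
    qed
    moreover have "w ` {1..S} = u ` {1..S}" by (rule image_cong) (simp_all add: w_def)
    moreover have "{0..S} = insert 0 {1..S}" by auto
    ultimately show ?thesis using z by (simp add: w_def)
  qed
  have "(\<Sum>i\<in>{0..S}. r i *\<^sub>C Q (w i)) = (1 / (\<tau> * c ^ S)) *\<^sub>C 1"
    unfolding r_def by (rule divided_difference[OF poly _ inj_w]) auto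
  moreover have "{0..S} = insert 0 {1..S}" by auto
  ultimately have sum: "r 0 *\<^sub>C Q z + (\<Sum>i\<in>{1..S}. r i *\<^sub>C Q (u i)) = (1 / (\<tau> * c ^ S)) *\<^sub>C 1"
    by (simp add: w_def)
  have P0: "\<nu> z * P * Q z = \<phi> z *\<^sub>C P"
  proof -
    have "\<nu> z * P = P * \<nu> z" unfolding P_def by (rule prod_list_commute) (rule comm)
    then show ?thesis by (simp add: mult.assoc quot)
  qed
  have Pu: "\<nu> z * P * Q (u i) = \<phi> (u i) *\<^sub>C (\<nu> z * Pi i)" if "i \<in> {1..S}" for i
  proof -
    have "Pi i * \<nu> (u i) = P"
      unfolding P_def Pi_def using that by (intro prod_list_remove comm) auto
    then have "\<nu> z * P * Q (u i) = \<nu> z * Pi i * (\<nu> (u i) * Q (u i))"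
      by (metis mult.assoc)
    then show ?thesis by (simp add: quot)
  qed
  have r0: "\<tau> * c ^ S * r 0 = \<tau> * (\<Prod>j = 1..S. g c z (u j))"
  proof -
    have "{0..S} - {0} = {1..S}" by auto
    then have "r 0 = (\<Prod>j\<in>{1..S}. 1 / (z - u j))" by (simp add: r_def w_def)
    moreover have "(\<Prod>j = 1..S. g c z (u j)) = c ^ S * (\<Prod>j\<in>{1..S}. 1 / (z - u j))"
      by (simp add: g_def prod_dividef)
    ultimately show ?thesis by simp
  qed
  \<comment> \<open>The power c^S is shared out among S functions \<open>g\<close>: S - 1 of them
    pair u_i with the other u_j, and one pairs u_i with z.\<close>
  have ri: "\<tau> * c ^ S * r i = \<tau> * (g c (u i) z * (\<Prod>j\<in>{1..S} - {i}. g c (u i) (u j)))"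
    if i: "i \<in> {1..S}" for i
  proof -
    have "{0..S} - {i} = insert 0 ({1..S} - {i})" using i by auto
    then have "r i = 1 / (u i - z) * (\<Prod>j\<in>{1..S} - {i}. 1 / (u i - u j))"
      using i by (simp add: r_def w_def)
    moreover have "(\<Prod>j\<in>{1..S} - {i}. g c (u i) (u j)) = c ^ (S - 1) * (\<Prod>j\<in>{1..S} - {i}. 1 / (u i - u j))"
      using i by (simp add: g_def prod_dividef)
    moreover have "c ^ S = c * c ^ (S - 1)" using i by (cases S) auto
    ultimately show ?thesis by (simp add: g_def)
  qed
  \<comment> \<open>The product of all \<nu> is multiplied by 1 in the form \<tau> c^S times the
    leading coefficient of \<open>Q\<close>, which is then replaced by the divided difference. Each
    \<open>Q\<close> cancels one \<nu>.\<close>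
  have "\<nu> z * P = (\<tau> * c ^ S) *\<^sub>C (\<nu> z * P * ((1 / (\<tau> * c ^ S)) *\<^sub>C 1))"
    using nz by simp
  also have "\<dots> = (\<tau> * c ^ S * r 0) *\<^sub>C (\<nu> z * P * Q z)
      + (\<Sum>i\<in>{1..S}. (\<tau> * c ^ S * r i) *\<^sub>C (\<nu> z * P * Q (u i)))"
    unfolding sum[symmetric] by (simp add: distrib_left scale_right_distrib sum_distrib_left scale_sum_right)
  also have "\<dots> = (\<tau> * (\<Prod>j = 1..S. g c z (u j)) * \<phi> z) *\<^sub>C P
      + (\<Sum>i\<in>{1..S}. (\<tau> * (g c (u i) z * (\<Prod>j\<in>{1..S} - {i}. g c (u i) (u j))) * \<phi> (u i)) *\<^sub>C (\<nu> z * Pi i))"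
    unfolding r0 P0 by (intro arg_cong2[where f = "(+)"] sum.cong) (simp_all add: ri Pu)
  also have "\<dots> = \<tau> *\<^sub>C ((\<phi> z * (\<Prod>j = 1..S. g c z (u j))) *\<^sub>C P
      + (\<Sum>i\<in>{1..S}. (g c (u i) z * \<phi> (u i) * (\<Prod>j\<in>{1..S} - {i}. g c (u i) (u j))) *\<^sub>C (\<nu> z * Pi i)))"
    by (simp add: scale_right_distrib scale_sum_right mult_ac)
  finally show ?thesis by (simp add: transfer_defect_def P_def Pi_def)
qed

text \<open>Perturbing \<nu> by t \<mu> gives trace t w. The defect is polynomial in t and vanishes
  off 0, hence also at 0.\<close>

lemma transfer_defect_zero_trace:
  assumes "\<And>t. t \<noteq> 0 \<Longrightarrow> transfer_defect c \<phi> S u z (t * w) (\<lambda>x. \<nu> x + t *\<^sub>C \<mu> x) = 0"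
  shows "transfer_defect c \<phi> S u z 0 \<nu> = 0"
proof -
  have lin: "is_polyfn (\<lambda>t. \<nu> x + t *\<^sub>C \<mu> x)" for x
    by (intro is_polyfn_add is_polyfn_const is_polyfn_id)
  have scale: "is_polyfn (\<lambda>t. (t * w) *\<^sub>C f t)" if "is_polyfn f" for f
    using is_polyfn_mult[OF is_polyfn_id[of "w *\<^sub>C 1"] that] by simp
  have "is_polyfn (\<lambda>t. transfer_defect c \<phi> S u z (t * w) (\<lambda>x. \<nu> x + t *\<^sub>C \<mu> x))"
    unfolding transfer_defect_def
    by (intro is_polyfn_diff is_polyfn_mult is_polyfn_prod_list lin scale is_polyfn_add
        is_polyfn_scale is_polyfn_sum finite_atLeastAtMost)
  from is_polyfn_zero[OF this assms] show ?thesis by simp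
qed

text \<open>In matrix form, G s = s' G at every site implies G T = T' G: the scalar part of each Lax
  operator commutes with \<open>G\<close>, which is passed through the chain site by site. No
  inverse of \<open>G\<close> occurs.\<close>

lemma mono_op_intertwine:
  assumes "\<And>i k l. i \<in> set is \<Longrightarrow> k < 2 \<Longrightarrow> l < 2 \<Longrightarrow>
      (\<Sum>p<2. G k p *\<^sub>C s i p l) = (\<Sum>p<2. G p l *\<^sub>C s' i k p)"
    and "k < 2" "l < 2"
  shows "(\<Sum>p<2. G k p *\<^sub>C mono_op c \<theta> s is x p l) = (\<Sum>p<2. G p l *\<^sub>C mono_op c \<theta> s' is x k p)"
  using assms
proof (induction "is" arbitrary: k l)
  case Nil
  then show ?case by (simp add: if_distrib[of "scale _"] sum.delta' cong: if_cong)
next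
  case (Cons i js)
  let ?L = "lax_op c \<theta> s i x" and ?L' = "lax_op c \<theta> s' i x"
  let ?T = "mono_op c \<theta> s js x" and ?T' = "mono_op c \<theta> s' js x"
  have L: "(\<Sum>p<2. G k p *\<^sub>C ?L p r) = (\<Sum>p<2. G p r *\<^sub>C ?L' k p)" if "r < 2" for r
  proof -
    have "(\<Sum>p<2. G k p *\<^sub>C (if p = r then b else 0)) = (\<Sum>p<2. G p r *\<^sub>C (if k = p then b else 0))" for b
      using that Cons.prems by (simp add: if_distrib[of "scale _"] sum.delta' cong: if_cong)
    moreover have "(\<Sum>p<2. G k p *\<^sub>C s i p r) = (\<Sum>p<2. G p r *\<^sub>C s' i k p)"
      using Cons.prems(1)[of i k r] Cons.prems(2) that by simp
    ultimately show ?thesis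
      unfolding lax_op_def scale_right_distrib sum.distrib by (simp only:)
  qed
  have "(\<Sum>p<2. G k p *\<^sub>C mono_op c \<theta> s (i # js) x p l)
      = (\<Sum>p<2. \<Sum>r<2. (G k p *\<^sub>C ?L p r) * ?T r l)"
    by (simp add: scale_sum_right)
  also have "\<dots> = (\<Sum>r<2. (\<Sum>p<2. G k p *\<^sub>C ?L p r) * ?T r l)"
    unfolding sum_distrib_right by (rule sum.swap)
  also have "\<dots> = (\<Sum>r<2. (\<Sum>p<2. G p r *\<^sub>C ?L' k p) * ?T r l)"
    by (intro sum.cong refl) (simp only: L lessThan_iff)
  also have "\<dots> = (\<Sum>p<2. \<Sum>r<2. ?L' k p * (G p r *\<^sub>C ?T r l))"
    unfolding sum_distrib_right by (subst sum.swap) simp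
  also have "\<dots> = (\<Sum>p<2. ?L' k p * (\<Sum>r<2. G r l *\<^sub>C ?T' p r))"
    using Cons by (intro sum.cong refl) (simp add: sum_distrib_left[symmetric] del: scale_mult_right)
  also have "\<dots> = (\<Sum>p<2. \<Sum>r<2. G r l *\<^sub>C (?L' k p * ?T' p r))"
    by (simp add: sum_distrib_left)
  also have "\<dots> = (\<Sum>r<2. G r l *\<^sub>C mono_op c \<theta> s' (i # js) x k r)"
    unfolding mono_op.simps scale_sum_right by (rule sum.swap)
  finally show ?case .
qed

end

context spin_chain
begin

theorem transfer_defect_mono:
  assumes "set is \<subseteq> I" "distinct is" "\<tau> \<noteq> 0" "S = sum_list (map d is)"
    and "inj_on u {1..S}" "z \<notin> u ` {1..S}"
  shows "transfer_defect c (eigen_prod is) S u z \<tau> (\<lambda>x. \<tau> *\<^sub>C T is x 0 0) = 0"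
proof -
  obtain Q where Q: "\<And>x. T is x 0 0 * Q x = eigen_prod is x *\<^sub>C 1"
      "polyfn S Q ((1 / c ^ S) *\<^sub>C 1)"
    using mono_quotient[OF assms(1,2)] assms(4) by blast
  have "polyfn S (\<lambda>x. (1 / \<tau>) *\<^sub>C Q x) ((1 / (\<tau> * c ^ S)) *\<^sub>C 1)"
    using polyfn_scale[OF Q(2), of "1 / \<tau>"] by simp
  then show ?thesis
    using assms c Q mono_commute[OF assms(1,2)] by (intro transfer_defect_quotient) auto
qed

end

subsection \<open>Matrices as elements of a ring type\<close>

text \<open>Matrices of a size given by a term do not form a type. Linear maps on sequences do, and
  a matrix of any positive size can act on them, so one ring serves all chains.\<close>

typedef lin_op = "{f :: (nat \<Rightarrow> complex) \<Rightarrow> nat \<Rightarrow> complex.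
    (\<forall>x y. f (\<lambda>i. x i + y i) = (\<lambda>i. f x i + f y i)) \<and> (\<forall>r x. f (\<lambda>i. r * x i) = (\<lambda>i. r * f x i))}"
  by (rule exI[of _ "\<lambda>x. x"]) simp

setup_lifting type_definition_lin_op

instantiation lin_op :: ring_1
begin

lift_definition zero_lin_op :: lin_op is "\<lambda>x i. 0" by simp
lift_definition one_lin_op :: lin_op is "\<lambda>x. x" by simp
lift_definition plus_lin_op :: "lin_op \<Rightarrow> lin_op \<Rightarrow> lin_op" is "\<lambda>f h x i. f x i + h x i"
  by (elim conjE, intro conjI allI; simp only:; simp (no_asm) add: fun_eq_iff algebra_simps)
lift_definition minus_lin_op :: "lin_op \<Rightarrow> lin_op \<Rightarrow> lin_op" is "\<lambda>f h x i. f x i - h x i"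
  by (elim conjE, intro conjI allI; simp only:; simp (no_asm) add: fun_eq_iff algebra_simps)
lift_definition uminus_lin_op :: "lin_op \<Rightarrow> lin_op" is "\<lambda>f x i. - f x i"
  by (elim conjE, intro conjI allI; simp only:; simp (no_asm) add: fun_eq_iff algebra_simps)
lift_definition times_lin_op :: "lin_op \<Rightarrow> lin_op \<Rightarrow> lin_op" is "\<lambda>f h x. f (h x)"
  by simp

instance
proof
  fix a b c :: lin_op
  show "a + b + c = a + (b + c)" by transfer (simp add: add.assoc)
  show "a + b = b + a" by transfer (simp add: add.commute)
  show "0 + a = a" by transfer simp
  show "- a + a = 0" by transfer simp
  show "a - b = a + - b" by transfer simp
  show "a * b * c = a * (b * c)" by transfer simp
  show "1 * a = a" by transfer simp
  show "a * 1 = a" by transfer simp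
  show "(a + b) * c = a * c + b * c" by transfer simp
  show "a * (b + c) = a * b + a * c" by transfer (elim conjE, intro ext, simp only:)
  show "(0::lin_op) \<noteq> 1" 
    by transfer (auto simp: fun_eq_iff intro!: exI[of _ "\<lambda>_. 1"])
qed

end

lift_definition scale_lin_op :: "complex \<Rightarrow> lin_op \<Rightarrow> lin_op" is "\<lambda>r f x i. r * f x i"
  by (elim conjE, intro conjI allI; simp only:; simp (no_asm) add: fun_eq_iff algebra_simps)

interpretation lin_op: complex_algebra scale_lin_op
proof unfold_locales
  fix r t :: complex and x y :: lin_op
  show "scale_lin_op r (x + y) = scale_lin_op r x + scale_lin_op r y"
    by transfer (simp (no_asm) add: distrib_left)
  show "scale_lin_op (r + t) x = scale_lin_op r x + scale_lin_op t x"
    by transfer (simp (no_asm) add: distrib_right)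
  show "scale_lin_op r (scale_lin_op t x) = scale_lin_op (r * t) x"
    by transfer (simp (no_asm) add: mult.assoc)
  show "scale_lin_op 1 x = x"
    by transfer simp
  show "scale_lin_op r x * y = scale_lin_op r (x * y)"
    by transfer (simp (no_asm))
  show "x * scale_lin_op r y = scale_lin_op r (x * y)"
    by transfer (elim conjE, intro ext, simp only:)
qed

text \<open>
  A matrix acts on sequences blockwise, so that the identity matrix of any positive size
  becomes the identity operator.
\<close>

lift_definition block_op :: "nat \<Rightarrow> complex mat \<Rightarrow> lin_op" is
  "\<lambda>n A x i. \<Sum>j<n. A $$ (i mod n, j) * x (n * (i div n) + j)"
  by (simp add: fun_eq_iff sum.distrib distrib_left sum_distrib_left mult_ac)

context
  fixes n :: nat
  assumes n: "0 < n"
begin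

lemma block_op_inject:
  assumes "A \<in> carrier_mat n n" "B \<in> carrier_mat n n" "block_op n A = block_op n B"
  shows "A = B"
proof (rule eq_matI)
  fix i j assume "i < dim_row B" "j < dim_col B"
  then have ij: "i < n" "j < n" using assms by auto
  \<comment> \<open>Evaluation at the j-th unit sequence; as i < n lies in block 0, the coordinate i
    of the image is the matrix entry.\<close>
  have "Rep_lin_op (block_op n A) (\<lambda>l. of_bool (l = j)) i = Rep_lin_op (block_op n B) (\<lambda>l. of_bool (l = j)) i"
    by (simp only: assms(3))
  then show "A $$ (i, j) = B $$ (i, j)"
    using ij by (simp add: block_op.rep_eq of_bool_def if_distrib cong: if_cong)
qed (use assms(1,2) in auto)

lemma block_op_add:
  "A \<in> carrier_mat n n \<Longrightarrow> B \<in> carrier_mat n n \<Longrightarrow> block_op n (A + B) = block_op n A + block_op n B"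
  by transfer (use n in \<open>simp add: fun_eq_iff distrib_right sum.distrib\<close>)

lemma block_op_minus:
  "A \<in> carrier_mat n n \<Longrightarrow> B \<in> carrier_mat n n \<Longrightarrow> block_op n (A - B) = block_op n A - block_op n B"
  by transfer (use n in \<open>simp add: fun_eq_iff left_diff_distrib sum_subtractf\<close>)

lemma block_op_uminus: "A \<in> carrier_mat n n \<Longrightarrow> block_op n (- A) = - block_op n A"
  by transfer (use n in \<open>simp add: fun_eq_iff sum_negf\<close>)

lemma block_op_smult: "A \<in> carrier_mat n n \<Longrightarrow> block_op n (r \<cdot>\<^sub>m A) = scale_lin_op r (block_op n A)"
  by transfer (use n in \<open>auto simp: fun_eq_iff sum_distrib_left mult_ac\<close>)

lemma block_op_zero: "block_op n (0\<^sub>m n n) = 0"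
  by transfer (use n in \<open>auto simp: fun_eq_iff\<close>)

lemma block_op_one: "block_op n (1\<^sub>m n) = 1"
proof -
  have "(\<Sum>j<n. 1\<^sub>m n $$ (i mod n, j) * x (n * (i div n) + j)) = x i" for i and x :: "nat \<Rightarrow> complex"
  proof -
    have "(\<Sum>j<n. 1\<^sub>m n $$ (i mod n, j) * x (n * (i div n) + j))
        = (\<Sum>j<n. if j = i mod n then x (n * (i div n) + j) else 0)"
      using n by (intro sum.cong) auto
    then show ?thesis using n by simp
  qed
  then show ?thesis by transfer (simp add: fun_eq_iff)
qed

lemma block_op_mult:
  assumes A: "A \<in> carrier_mat n n" and B: "B \<in> carrier_mat n n"
  shows "block_op n (A * B) = block_op n A * block_op n B"
proof -
  have "(\<Sum>j<n. (A * B) $$ (i mod n, j) * x (n * (i div n) + j))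
      = (\<Sum>k<n. A $$ (i mod n, k) *
          (\<Sum>j<n. B $$ ((n * (i div n) + k) mod n, j) * x (n * ((n * (i div n) + k) div n) + j)))"
    for i and x :: "nat \<Rightarrow> complex"
  proof -
    have "(\<Sum>j<n. (A * B) $$ (i mod n, j) * x (n * (i div n) + j))
        = (\<Sum>j<n. \<Sum>k<n. A $$ (i mod n, k) * (B $$ (k, j) * x (n * (i div n) + j)))"
      using A B n
      by (intro sum.cong refl) (simp add: scalar_prod_def sum_distrib_left sum_distrib_right mult_ac atLeast0LessThan)
    also have "\<dots> = (\<Sum>k<n. A $$ (i mod n, k) * (\<Sum>j<n. B $$ (k, j) * x (n * (i div n) + j)))"
      by (subst sum.swap) (simp add: sum_distrib_left)
    finally show ?thesis using n by simp
  qed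
  then show ?thesis by transfer (simp add: fun_eq_iff)
qed

lemmas block_op_simps =
  block_op_add block_op_minus block_op_uminus block_op_smult block_op_zero block_op_one block_op_mult

end

subsection \<open>Tensor products\<close>

lemma dim_kronecker [simp]:
  "dim_row (kronecker A B) = dim_row A * dim_row B" "dim_col (kronecker A B) = dim_col A * dim_col B"
  by (simp_all add: kronecker_def)

lemma kronecker_carrier [simp]:
  assumes "A \<in> carrier_mat m n" "B \<in> carrier_mat p q"
  shows "kronecker A B \<in> carrier_mat (m * p) (n * q)"
  using assms by (intro carrier_matI) simp_all

lemma div_mod_less:
  fixes i :: nat
  assumes "i < m * n"
  shows "i div n < m" "i mod n < n"
proof -
  from assms have "0 < n" by (metis gr0I mult_0_right not_less_zero)
  then show "i mod n < n" by (rule mod_less_divisor)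
  from assms show "i div n < m" by (rule less_mult_imp_div_less)
qed

lemma kronecker_mult:
  assumes "A \<in> carrier_mat m m" "B \<in> carrier_mat n n" "C \<in> carrier_mat m m" "D \<in> carrier_mat n n"
  shows "kronecker A B * kronecker C D = kronecker (A * C) (B * D)"
proof (rule eq_matI)
  fix i j assume "i < dim_row (kronecker (A * C) (B * D))" "j < dim_col (kronecker (A * C) (B * D))"
  then have i: "i < m * n" and j: "j < m * n" using assms by auto
  note ij = div_mod_less[OF i] div_mod_less[OF j]
  have less: "p * n + q < m * n" if "p < m" "q < n" for p q
    using mult_le_mono1[of "Suc p" m n] that by simp
  have "(kronecker A B * kronecker C D) $$ (i, j)
      = (\<Sum>k<m * n. (A $$ (i div n, k div n) * C $$ (k div n, j div n)) *
          (B $$ (i mod n, k mod n) * D $$ (k mod n, j mod n)))"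
    using assms i j by (simp add: scalar_prod_def atLeast0LessThan)
      (simp add: kronecker_def mult_ac)
  also have "\<dots> = (\<Sum>p<m. \<Sum>q<n. (A $$ (i div n, p) * C $$ (p, j div n)) *
          (B $$ (i mod n, q) * D $$ (q, j mod n)))"
    unfolding sum.cartesian_product
    by (rule sum.reindex_bij_witness[of _ "\<lambda>(p, q). p * n + q" "\<lambda>k. (k div n, k mod n)"])
      (auto intro: div_mod_less less)
  also have "\<dots> = kronecker (A * C) (B * D) $$ (i, j)"
    using assms i j ij by (simp add: kronecker_def scalar_prod_def atLeast0LessThan sum_product)
  finally show "(kronecker A B * kronecker C D) $$ (i, j) = kronecker (A * C) (B * D) $$ (i, j)" .
qed (use assms in simp_all)

subsection \<open>Weights of an irreducible spin representation\<close>

lemma card_eigenvalues_le: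
  fixes A :: "complex mat"
  assumes A: "A \<in> carrier_mat n n" and inj: "inj_on e K" and K: "finite K"
    and v: "\<And>k. k \<in> K \<Longrightarrow> v k \<in> carrier_vec n \<and> v k \<noteq> 0\<^sub>v n \<and> A *\<^sub>v v k = e k \<cdot>\<^sub>v v k"
  shows "card K \<le> n"
proof -
  have "e ` K \<subseteq> spectrum A"
    using v A by (auto simp: spectrum_def eigenvalue_def eigenvector_def) blast
  then have "card (e ` K) \<le> card (spectrum A)"
    by (intro card_mono card_finite_spectrum(1)[OF A])
  then show ?thesis
    using card_finite_spectrum(2)[OF A] inj by (simp add: card_image)
qed

lemma smult_mat_mult_mat_vec:
  fixes A :: "'a::comm_ring_1 mat"
  assumes "A \<in> carrier_mat m n" "v \<in> carrier_vec n"
  shows "(r \<cdot>\<^sub>m A) *\<^sub>v v = r \<cdot>\<^sub>v (A *\<^sub>v v)"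
  using assms by (intro eq_vecI) simp_all

lemma eigenvector_shift:
  fixes A X :: "complex mat"
  assumes A: "A \<in> carrier_mat n n" and X: "X \<in> carrier_mat n n" and v: "v \<in> carrier_vec n"
    and comm: "A * X - X * A = \<delta> \<cdot>\<^sub>m X" and eig: "A *\<^sub>v v = \<mu> \<cdot>\<^sub>v v"
  shows "A *\<^sub>v (X *\<^sub>v v) = (\<mu> + \<delta>) \<cdot>\<^sub>v (X *\<^sub>v v)"
proof -
  have "A * X = (A * X - X * A) + X * A"
    using A X by (intro eq_matI) auto
  then have "A * X = \<delta> \<cdot>\<^sub>m X + X * A" by (simp only: comm)
  then have "A *\<^sub>v (X *\<^sub>v v) = (\<delta> \<cdot>\<^sub>m X + X * A) *\<^sub>v v"
    using A X v by (metis assoc_mult_mat_vec)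
  also have "\<dots> = \<delta> \<cdot>\<^sub>v (X *\<^sub>v v) + X *\<^sub>v (A *\<^sub>v v)"
    using A X v by (simp add: add_mult_distrib_mat_vec[of _ n n] smult_mat_mult_mat_vec[of _ n n]
        assoc_mult_mat_vec[of _ n n])
  also have "\<dots> = (\<mu> + \<delta>) \<cdot>\<^sub>v (X *\<^sub>v v)"
    using X v by (simp add: eig mult_mat_vec[of _ n n] add_smult_distrib_vec[symmetric] add.commute)
  finally show ?thesis .
qed

text \<open>The ladder must stop: n + 1 nonzero vectors on it would be eigenvectors for n + 1
  distinct eigenvalues.\<close>

lemma eigenvector_chain:
  fixes A X :: "complex mat"
  assumes A: "A \<in> carrier_mat n n" and X: "X \<in> carrier_mat n n" and v: "v \<in> carrier_vec n"
    and comm: "A * X - X * A = \<delta> \<cdot>\<^sub>m X" and eig: "A *\<^sub>v v = \<mu> \<cdot>\<^sub>v v" and \<delta>: "\<delta> \<noteq> 0"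
  defines "c \<equiv> \<lambda>k. ((*\<^sub>v) X ^^ k) v"
  shows "c k \<in> carrier_vec n"
    and "A *\<^sub>v c k = (\<mu> + of_nat k * \<delta>) \<cdot>\<^sub>v c k"
    and "\<exists>k\<le>n. c k = 0\<^sub>v n"
proof -
  have car: "c k \<in> carrier_vec n" for k
    unfolding c_def by (induction k) (use X v in auto)
  then show "c k \<in> carrier_vec n" .
  have ev: "A *\<^sub>v c k = (\<mu> + of_nat k * \<delta>) \<cdot>\<^sub>v c k" for k
  proof (induction k)
    case 0
    show ?case by (simp add: c_def eig)
  next
    case (Suc k)
    have "c (Suc k) = X *\<^sub>v c k" by (simp add: c_def)
    with eigenvector_shift[OF A X car comm Suc] show ?case by (simp add: algebra_simps)
  qed
  then show "A *\<^sub>v c k = (\<mu> + of_nat k * \<delta>) \<cdot>\<^sub>v c k" .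
  show "\<exists>k\<le>n. c k = 0\<^sub>v n"
  proof (rule ccontr)
    assume "\<not> ?thesis"
    then have "card {..n} \<le> n"
      using car ev \<delta> by (intro card_eigenvalues_le[OF A, of "\<lambda>k. \<mu> + of_nat k * \<delta>" _ c]) (auto simp: inj_on_def)
    then show False by simp
  qed
qed

text \<open>Linear combinations of vectors are written coordinatewise, so that ordinary complex sums
  suffice.\<close>

lemma mult_mat_vec_sum_index:
  fixes X :: "complex mat"
  assumes X: "X \<in> carrier_mat n n" and v: "\<And>k. v k \<in> carrier_vec n" and w: "w \<in> carrier_vec n"
    and eq: "\<And>i. i < n \<Longrightarrow> w $ i = (\<Sum>k<m. a k * v k $ i)" and i: "i < n"
  shows "(X *\<^sub>v w) $ i = (\<Sum>k<m. a k * (X *\<^sub>v v k) $ i)"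
proof -
  have dim: "dim_vec (v k) = n" for k using v carrier_vecD by blast
  have "(X *\<^sub>v w) $ i = (\<Sum>j<n. X $$ (i, j) * (\<Sum>k<m. a k * v k $ j))"
    using X w i eq by (simp add: scalar_prod_def atLeast0LessThan)
  also have "\<dots> = (\<Sum>j<n. \<Sum>k<m. a k * (X $$ (i, j) * v k $ j))"
    by (simp add: sum_distrib_left mult_ac)
  also have "\<dots> = (\<Sum>k<m. a k * (X *\<^sub>v v k) $ i)"
    using X i dim by (subst sum.swap) (simp add: scalar_prod_def atLeast0LessThan sum_distrib_left)
  finally show ?thesis .
qed

text \<open>The matrix counterpart of \<open>weight_prod\<close>, to be carried over to the ring
  type once it is known to vanish.\<close>

primrec weight_mat :: "nat \<Rightarrow> complex mat \<Rightarrow> nat \<Rightarrow> complex mat" where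
  "weight_mat d A 0 = 1\<^sub>m (d + 1)"
| "weight_mat d A (Suc k) = weight_mat d A k * (weight d k \<cdot>\<^sub>m 1\<^sub>m (d + 1) - A)"

lemma weight_mat_carrier [simp]:
  "A \<in> carrier_mat (d + 1) (d + 1) \<Longrightarrow> weight_mat d A k \<in> carrier_mat (d + 1) (d + 1)"
  by (induction k) (auto intro!: mult_carrier_mat minus_carrier_mat)

lemma irreducible_action_full:
  assumes irr: "irreducible_action n A"
    and W: "W \<subseteq> carrier_vec n" "0\<^sub>v n \<in> W" "\<And>x y. x \<in> W \<Longrightarrow> y \<in> W \<Longrightarrow> x + y \<in> W"
      "\<And>r x. x \<in> W \<Longrightarrow> r \<cdot>\<^sub>v x \<in> W"
    and inv: "\<And>X w. X \<in> A \<Longrightarrow> w \<in> W \<Longrightarrow> X *\<^sub>v w \<in> W"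
    and v: "v \<in> W" "v \<noteq> 0\<^sub>v n"
  shows "W = carrier_vec n"
proof -
  have "VectorSpace.subspace class_ring W (module_vec TYPE(complex) n)"
    unfolding VectorSpace.subspace_def submodule_def using W vec_vs vec_module
    by (auto simp: module_vec_simps)
  then have "W = {0\<^sub>v n} \<or> W = carrier_vec n"
    using irr inv unfolding irreducible_action_def by blast
  then show ?thesis using v by blast
qed

text \<open>Raising an eigenvector of \<open>S3\<close> until it dies yields a highest weight
  vector. Its lowered images span an invariant subspace, hence everything, so there are d + 1
  nonzero ones and their weights are those listed by \<open>weight\<close>; the product kills each
  of them.\<close>

theorem spin_irrep_weight_mat:
  assumes "spin_irrep d S3 Sp Sm"
  shows "weight_mat d S3 (Suc d) = 0\<^sub>m (d + 1) (d + 1)"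
proof -
  define n where "n = Suc d"
  have A: "S3 \<in> carrier_mat n n" and B: "Sp \<in> carrier_mat n n" and C: "Sm \<in> carrier_mat n n"
    and rel: "Sp * Sm - Sm * Sp = 2 \<cdot>\<^sub>m S3" "S3 * Sp - Sp * S3 = Sp" "S3 * Sm - Sm * S3 = - Sm"
    and irr: "irreducible_action n {S3, Sp, Sm}"
    using assms by (auto simp: spin_irrep_def spin_relations_def n_def)
  have commB: "S3 * Sp - Sp * S3 = 1 \<cdot>\<^sub>m Sp" using rel(2) B by auto
  have commC: "S3 * Sm - Sm * S3 = (- 1) \<cdot>\<^sub>m Sm" using rel(3) C by (auto intro!: eq_matI)
  have "spectrum S3 \<noteq> {}" by (rule spectrum_non_empty[OF A]) (simp add: n_def)
  then obtain \<mu> where "eigenvalue S3 \<mu>" by (auto simp: spectrum_def)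
  then obtain w where "eigenvector S3 w \<mu>" unfolding eigenvalue_def by blast
  then have w: "w \<in> carrier_vec n" "w \<noteq> 0\<^sub>v n" "S3 *\<^sub>v w = \<mu> \<cdot>\<^sub>v w"
    unfolding eigenvector_def carrier_matD(1)[OF A] by blast+
  define b where "b k = ((*\<^sub>v) Sp ^^ k) w" for k
  define K where "K = (LEAST k. b k = 0\<^sub>v n)"
  note b = eigenvector_chain[OF A B w(1) commB w(3) one_neq_zero, folded b_def]
  obtain k where "b k = 0\<^sub>v n" using b(3) by blast
  then have bK: "b K = 0\<^sub>v n" unfolding K_def by (rule LeastI)
  have "b 0 \<noteq> 0\<^sub>v n" using w(2) by (simp add: b_def)
  with bK have "K \<noteq> 0" by (cases "K = 0") simp_all
  then obtain K' where K': "K = Suc K'" by (cases K) simp_all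
  \<comment> \<open>The highest weight, reached after K' raisings; its value d / 2 is established
    only after the span is known to be full.\<close>
  define \<kappa> where "\<kappa> = \<mu> + of_nat K'"
  define v where "v k = ((*\<^sub>v) Sm ^^ k) (b K')" for k
  have v00: "v 0 = b K'" by (simp add: v_def)
  have "K' < K" by (simp add: K')
  then have v0: "v 0 \<noteq> 0\<^sub>v n" unfolding K_def v00 by (rule not_less_Least)
  have v0_S3: "S3 *\<^sub>v v 0 = \<kappa> \<cdot>\<^sub>v v 0"
    using b(2)[of K'] by (simp add: v00 \<kappa>_def)
  have v0_Sp: "Sp *\<^sub>v v 0 = 0\<^sub>v n"
    using bK by (simp add: v00 K' b_def)
  have "(- 1 :: complex) \<noteq> 0" by simp
  note chain = eigenvector_chain[OF A C b(1) commC v0_S3[unfolded v00] this, folded v_def]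
  have chain_S3: "S3 *\<^sub>v v k = (\<kappa> + of_nat k * - 1) \<cdot>\<^sub>v v k" for k
    by (rule chain(2))
  have vS: "Sm *\<^sub>v v k = v (Suc k)" for k by (simp add: v_def)
  have v_zero: "v k = 0\<^sub>v n" if "n \<le> k" for k
  proof -
    obtain m where m: "m \<le> n" "v m = 0\<^sub>v n" using chain(3) by blast
    have "v (m + j) = 0\<^sub>v n" for j
      by (induction j) (use m C in \<open>auto simp: vS[symmetric]\<close>)
    from this[of "k - m"] show ?thesis using that m by simp
  qed
  have up: "Sp *\<^sub>v v (Suc k) = (of_nat (Suc k) * (2 * \<kappa> - of_nat k)) \<cdot>\<^sub>v v k" for k
  proof -
    have BC: "Sp *\<^sub>v v (Suc k) = 2 \<cdot>\<^sub>v (S3 *\<^sub>v v k) + Sm *\<^sub>v (Sp *\<^sub>v v k)" for k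
    proof -
      have "Sp * Sm = (Sp * Sm - Sm * Sp) + Sm * Sp"
        using B C by (intro eq_matI) auto
      then have "Sp * Sm = 2 \<cdot>\<^sub>m S3 + Sm * Sp" by (simp only: rel)
      then have "Sp *\<^sub>v (Sm *\<^sub>v v k) = (2 \<cdot>\<^sub>m S3 + Sm * Sp) *\<^sub>v v k"
        using B C chain(1) by (metis assoc_mult_mat_vec)
      also have "\<dots> = 2 \<cdot>\<^sub>v (S3 *\<^sub>v v k) + Sm *\<^sub>v (Sp *\<^sub>v v k)"
        using A B C chain(1)[of k]
        by (simp add: add_mult_distrib_mat_vec[of _ n n] smult_mat_mult_mat_vec[of _ n n]
            assoc_mult_mat_vec[of _ n n])
      finally show ?thesis by (simp add: vS)
    qed
    show ?thesis
    proof (induction k)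
      case 0
      have "Sm *\<^sub>v (0\<^sub>v n :: complex vec) = 0\<^sub>v n" using C by auto
      then show ?case unfolding BC v0_Sp v0_S3
        using chain(1)[of 0] by (simp add: smult_smult_assoc)
    next
      case (Suc k)
      have "Sp *\<^sub>v v (Suc (Suc k)) = 2 \<cdot>\<^sub>v ((\<kappa> + of_nat (Suc k) * - 1) \<cdot>\<^sub>v v (Suc k))
          + Sm *\<^sub>v ((of_nat (Suc k) * (2 * \<kappa> - of_nat k)) \<cdot>\<^sub>v v k)"
        unfolding BC[of "Suc k"] Suc chain_S3 ..
      also have "\<dots> = (2 * (\<kappa> + of_nat (Suc k) * - 1) + of_nat (Suc k) * (2 * \<kappa> - of_nat k)) \<cdot>\<^sub>v v (Suc k)"
        by (simp only: mult_mat_vec[OF C chain(1)] vS smult_smult_assoc add_smult_distrib_vec[symmetric])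
      also have "2 * (\<kappa> + of_nat (Suc k) * - 1) + of_nat (Suc k) * (2 * \<kappa> - of_nat k)
          = of_nat (Suc (Suc k)) * (2 * \<kappa> - of_nat (Suc k))"
        by (simp add: algebra_simps)
      finally show ?case .
    qed
  qed
  have dim: "dim_vec (v k) = n" for k using chain(1) carrier_vecD by blast
  define W where "W = {x \<in> carrier_vec n. \<exists>a. \<forall>i<n. x $ i = (\<Sum>k<n. a k * v k $ i)}"
  have W_I: "x \<in> W" if "x \<in> carrier_vec n" "\<And>i. i < n \<Longrightarrow> x $ i = (\<Sum>k<n. a k * v k $ i)" for x a
    unfolding W_def using that by blast
  have full: "W = carrier_vec n"
  proof (rule irreducible_action_full[OF irr])
    show "W \<subseteq> carrier_vec n" by (auto simp: W_def)
    show "0\<^sub>v n \<in> W" by (rule W_I[of _ "\<lambda>_. 0"]) auto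
    show "x + y \<in> W" if xy: "x \<in> W" "y \<in> W" for x y
    proof -
      obtain a a' where "\<forall>i<n. x $ i = (\<Sum>k<n. a k * v k $ i)" "\<forall>i<n. y $ i = (\<Sum>k<n. a' k * v k $ i)"
        using xy unfolding W_def by blast
      then show ?thesis using xy
        by (intro W_I[of _ "\<lambda>k. a k + a' k"]) (auto simp: W_def distrib_right sum.distrib)
    qed
    show "r \<cdot>\<^sub>v x \<in> W" if xy: "x \<in> W" for r x
    proof -
      obtain a where "\<forall>i<n. x $ i = (\<Sum>k<n. a k * v k $ i)"
        using xy unfolding W_def by blast
      then show ?thesis using xy
        by (intro W_I[of _ "\<lambda>k. r * a k"]) (auto simp: W_def sum_distrib_left mult_ac)
    qed
    show "v 0 \<in> W"
    proof (rule W_I[of _ "\<lambda>k. of_bool (k = 0)"])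
      show "v 0 $ i = (\<Sum>k<n. of_bool (k = 0) * v k $ i)" if "i < n" for i
        by (simp add: n_def sum.lessThan_Suc_shift del: sum.lessThan_Suc)
    qed (rule chain(1))
    show "v 0 \<noteq> 0\<^sub>v n" by (rule v0)
    show "X *\<^sub>v x \<in> W" if X: "X \<in> {S3, Sp, Sm}" and x: "x \<in> W" for X x
    proof -
      obtain a where a: "\<And>i. i < n \<Longrightarrow> x $ i = (\<Sum>k<n. a k * v k $ i)" and xc: "x \<in> carrier_vec n"
        using x unfolding W_def by blast
      have Xc: "X \<in> carrier_mat n n" using X A B C by auto
      have idx: "(X *\<^sub>v x) $ i = (\<Sum>k<n. a k * (X *\<^sub>v v k) $ i)" if "i < n" for i
        by (rule mult_mat_vec_sum_index[OF Xc chain(1) xc _ that]) (rule a)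
      consider "X = S3" | "X = Sp" | "X = Sm" using X by blast
      then show ?thesis
      proof cases
        case 1
        have "(X *\<^sub>v x) $ i = (\<Sum>k<n. a k * (\<kappa> - of_nat k) * v k $ i)" if i: "i < n" for i
          using idx[OF i] i dim unfolding 1 chain_S3 by (simp add: mult.assoc del: index_mult_mat_vec)
        then show ?thesis using Xc xc by (intro W_I) auto
      next
        case 2
        \<comment> \<open>Raising shifts the coefficients down by one, so the last vector v_d
          receives none.\<close>
        have "(X *\<^sub>v x) $ i = (\<Sum>k<n. (if k < d then a (Suc k) * (of_nat (Suc k) * (2 * \<kappa> - of_nat k)) else 0) * v k $ i)"
          if i: "i < n" for i
        proof -
          have "(X *\<^sub>v x) $ i = (\<Sum>k<d. a (Suc k) * (Sp *\<^sub>v v (Suc k)) $ i)"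
            using idx[OF i] v0_Sp i unfolding 2 by (simp add: n_def sum.lessThan_Suc_shift del: sum.lessThan_Suc index_mult_mat_vec)
          then show ?thesis
            using i dim by (simp add: up n_def mult.assoc del: index_mult_mat_vec of_nat_Suc)
        qed
        then show ?thesis using Xc xc by (intro W_I) auto
      next
        case 3
        have "(X *\<^sub>v x) $ i = (\<Sum>k<n. (case k of 0 \<Rightarrow> 0 | Suc l \<Rightarrow> a l) * v k $ i)" if i: "i < n" for i
        proof -
          have "(X *\<^sub>v x) $ i = (\<Sum>k<n. a k * v (Suc k) $ i)"
            using idx[OF i] unfolding 3 vS .
          \<comment> \<open>The lowered last vector is v_n = 0, which keeps the combination within
            the n spanning vectors.\<close>
          also have "\<dots> = (\<Sum>k<d. a k * v (Suc k) $ i)"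
            using v_zero[of n] i by (simp add: n_def)
          finally show ?thesis
            by (simp add: n_def sum.lessThan_Suc_shift del: sum.lessThan_Suc)
        qed
        then show ?thesis using Xc xc by (intro W_I) auto
      qed
    qed
  qed
  have span: "\<exists>a. \<forall>i<n. x $ i = (\<Sum>k<n. a k * v k $ i)" if "x \<in> carrier_vec n" for x
    using that full unfolding W_def by blast
  \<comment> \<open>If v_d were zero, the spanning matrix \<open>M\<close> with columns v_k would
    have a zero column. A right inverse \<open>R\<close> of \<open>M\<close> is also a left inverse,
    yet the diagonal entry (d, d) of \<open>R * M\<close> would be 0.\<close>
  have vd: "v d \<noteq> 0\<^sub>v n"
  proof
    assume vd: "v d = 0\<^sub>v n"
    obtain a where a: "\<And>j i. i < n \<Longrightarrow> unit_vec n j $ i = (\<Sum>k<n. a j k * v k $ i)"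
      using span[of "unit_vec n _"] by (metis unit_vec_carrier)
    define M where "M = mat n n (\<lambda>(i, k). v k $ i)"
    define R where "R = mat n n (\<lambda>(k, j). a j k)"
    have M: "M \<in> carrier_mat n n" and R: "R \<in> carrier_mat n n" by (auto simp: M_def R_def)
    have "M * R = 1\<^sub>m n"
    proof (rule eq_matI)
      fix i j assume "i < dim_row (1\<^sub>m n :: complex mat)" "j < dim_col (1\<^sub>m n :: complex mat)"
      then have ij: "i < n" "j < n" by auto
      have "(M * R) $$ (i, j) = (\<Sum>k<n. a j k * v k $ i)"
        using ij by (simp add: M_def R_def scalar_prod_def atLeast0LessThan mult.commute)
      also have "\<dots> = unit_vec n j $ i" by (rule a[symmetric]) (rule ij)
      finally show "(M * R) $$ (i, j) = 1\<^sub>m n $$ (i, j)" using ij by simp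
    qed (auto simp: M_def R_def)
    then have RM: "R * M = 1\<^sub>m n" by (rule mat_mult_left_right_inverse[OF M R])
    have "(R * M) $$ (d, d) = 0"
      using vd by (simp add: M_def R_def scalar_prod_def n_def)
    then show False unfolding RM by (simp add: n_def)
  qed
  \<comment> \<open>By \<open>up\<close> at k = d: v_{d+1} is zero and v_d is not, so the raising
    coefficient must vanish. This ties the highest weight to the dimension.\<close>
  have \<kappa>: "\<kappa> = of_nat d / 2"
  proof -
    have "Sp *\<^sub>v (0\<^sub>v n :: complex vec) = 0\<^sub>v n" using B by auto
    moreover have "v (Suc d) = 0\<^sub>v n" by (rule v_zero) (simp add: n_def)
    ultimately have "Sp *\<^sub>v v (Suc d) = 0\<^sub>v n" by simp
    then have eq: "(of_nat (Suc d) * (2 * \<kappa> - of_nat d)) \<cdot>\<^sub>v v d = 0\<^sub>v n" unfolding up .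
    have "of_nat (Suc d) * (2 * \<kappa> - of_nat d) = 0"
    proof (rule ccontr)
      let ?r = "of_nat (Suc d) * (2 * \<kappa> - of_nat d)"
      assume "?r \<noteq> 0"
      then have "v d = (1 / ?r) \<cdot>\<^sub>v (?r \<cdot>\<^sub>v v d)" by (simp add: smult_smult_assoc del: of_nat_Suc)
      also have "\<dots> = 0\<^sub>v n" unfolding eq by auto
      finally show False using vd by simp
    qed
    then show ?thesis by (simp add: field_simps del: of_nat_Suc)
  qed
  have nd: "d + 1 = n" by (simp add: n_def)
  have Wcar: "weight_mat d S3 m \<in> carrier_mat n n" for m
    using weight_mat_carrier[of S3 d m] A unfolding nd .
  \<comment> \<open>The factor for the weight l acts on v_k as (d/2 - l) - (d/2 - k) = k - l, so the
    full product contains the zero factor l = k.\<close>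
  have kill: "weight_mat d S3 m *\<^sub>v v k = (\<Prod>l<m. of_nat k - of_nat l) \<cdot>\<^sub>v v k" for m k
  proof (induction m)
    case 0
    show ?case using chain(1)[of k] by (simp add: nd del: One_nat_def add_Suc_right)
  next
    case (Suc m)
    have D: "weight d m \<cdot>\<^sub>m 1\<^sub>m n - S3 \<in> carrier_mat n n" using A by (simp add: minus_carrier_mat)
    have "(weight d m \<cdot>\<^sub>m 1\<^sub>m n - S3) *\<^sub>v v k = (weight d m \<cdot>\<^sub>m 1\<^sub>m n) *\<^sub>v v k - S3 *\<^sub>v v k"
      by (rule minus_mult_distrib_mat_vec[OF _ A chain(1)]) simp
    also have "\<dots> = weight d m \<cdot>\<^sub>v v k - (\<kappa> + of_nat k * - 1) \<cdot>\<^sub>v v k"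
      by (simp only: chain_S3 smult_mat_mult_mat_vec[OF one_carrier_mat chain(1)] one_mult_mat_vec[OF chain(1)])
    also have "\<dots> = (of_nat k - of_nat m) \<cdot>\<^sub>v v k"
      using dim by (intro eq_vecI) (auto simp: \<kappa> weight_def algebra_simps)
    finally have eq: "(weight d m \<cdot>\<^sub>m 1\<^sub>m n - S3) *\<^sub>v v k = (of_nat k - of_nat m) \<cdot>\<^sub>v v k" .
    show ?case
      unfolding weight_mat.simps nd assoc_mult_mat_vec[OF Wcar D chain(1)] eq
        mult_mat_vec[OF Wcar chain(1)] Suc smult_smult_assoc
      by (simp add: mult.commute)
  qed
  have zero: "weight_mat d S3 n *\<^sub>v x = 0\<^sub>v n" if x: "x \<in> carrier_vec n" for x
  proof (rule eq_vecI)
    note P = Wcar[of n]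
    then show "dim_vec (weight_mat d S3 n *\<^sub>v x) = dim_vec (0\<^sub>v n)" by simp
    fix i assume "i < dim_vec (0\<^sub>v n :: complex vec)"
    then have i: "i < n" by simp
    obtain a where a: "\<And>i. i < n \<Longrightarrow> x $ i = (\<Sum>k<n. a k * v k $ i)" using span[OF x] by blast
    have "(weight_mat d S3 n *\<^sub>v x) $ i = (\<Sum>k<n. a k * ((\<Prod>l<n. of_nat k - of_nat l) \<cdot>\<^sub>v v k) $ i)"
      unfolding kill[symmetric] by (rule mult_mat_vec_sum_index[OF P chain(1) x _ i]) (rule a)
    also have "\<dots> = (\<Sum>k<n. 0)"
    proof (rule sum.cong)
      fix k assume "k \<in> {..<n}"
      then have "(\<Prod>l<n. of_nat k - of_nat l :: complex) = 0" by (intro prod_zero) auto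
      then show "a k * ((\<Prod>l<n. of_nat k - of_nat l) \<cdot>\<^sub>v v k) $ i = 0" using i dim by simp
    qed simp
    finally show "(weight_mat d S3 n *\<^sub>v x) $ i = 0\<^sub>v n $ i" using i by simp
  qed
  show ?thesis
  proof (rule eq_matI)
    note P = Wcar[of n]
    fix i j assume "i < dim_row (0\<^sub>m (d + 1) (d + 1) :: complex mat)" "j < dim_col (0\<^sub>m (d + 1) (d + 1) :: complex mat)"
    then have ij: "i < n" "j < n" by (auto simp: n_def)
    have "weight_mat d S3 n $$ (i, j) = (weight_mat d S3 n *\<^sub>v unit_vec n j) $ i"
      using P ij by (simp add: scalar_prod_right_unit)
    then show "weight_mat d S3 (Suc d) $$ (i, j) = 0\<^sub>m (d + 1) (d + 1) $$ (i, j)"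
      using ij unfolding zero[OF unit_vec_carrier] by (simp add: n_def)
  qed (use Wcar[of "Suc d"] nd in \<open>auto simp del: weight_mat.simps\<close>)
qed

subsection \<open>Rotation of the spin operators\<close>

text \<open>The three relations bring all products into one fixed order of the generators, after
  which coefficients are compared.\<close>

lemma (in complex_algebra) comb_commutator:
  assumes rel: "p * m - m * p = 2 *\<^sub>C s" "s * p - p * s = p" "s * m - m * s = - m"
  shows "(x *\<^sub>C s + y *\<^sub>C p + z *\<^sub>C m) * (x' *\<^sub>C s + y' *\<^sub>C p + z' *\<^sub>C m)
      - (x' *\<^sub>C s + y' *\<^sub>C p + z' *\<^sub>C m) * (x *\<^sub>C s + y *\<^sub>C p + z *\<^sub>C m)
    = (2 * (y * z' - y' * z)) *\<^sub>C s + (x * y' - x' * y) *\<^sub>C p + (x' * z - x * z') *\<^sub>C m"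
proof -
  have "p * m = m * p + 2 *\<^sub>C s" "s * p = p * s + p" using rel by (simp_all add: algebra_simps)
  moreover have "m * s = s * m + m" using rel(3) by (simp add: algebra_simps)
  ultimately show ?thesis by (simp add: algebra_simps)
qed

definition spin_comb :: "complex \<Rightarrow> complex \<Rightarrow> complex \<Rightarrow> complex mat \<Rightarrow> complex mat \<Rightarrow> complex mat \<Rightarrow> complex mat" where
  "spin_comb x y z S3 Sp Sm = x \<cdot>\<^sub>m S3 + y \<cdot>\<^sub>m Sp + z \<cdot>\<^sub>m Sm"

context
  fixes n :: nat and S3 Sp Sm :: "complex mat"
  assumes n: "0 < n"
    and S3: "S3 \<in> carrier_mat n n" and Sp: "Sp \<in> carrier_mat n n" and Sm: "Sm \<in> carrier_mat n n"
begin

lemma spin_comb_carrier: "spin_comb x y z S3 Sp Sm \<in> carrier_mat n n"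
  using S3 Sp Sm by (simp add: spin_comb_def)

lemma block_op_spin_comb:
  "block_op n (spin_comb x y z S3 Sp Sm)
    = scale_lin_op x (block_op n S3) + scale_lin_op y (block_op n Sp) + scale_lin_op z (block_op n Sm)"
  using n S3 Sp Sm by (simp add: spin_comb_def block_op_simps)

text \<open>The bilinear expansion is done in the ring type and pulled back through the injective
  \<open>block_op\<close>.\<close>

lemma spin_comb_commutator:
  assumes "spin_relations S3 Sp Sm"
  shows "spin_comb x y z S3 Sp Sm * spin_comb x' y' z' S3 Sp Sm
      - spin_comb x' y' z' S3 Sp Sm * spin_comb x y z S3 Sp Sm
    = spin_comb (2 * (y * z' - y' * z)) (x * y' - x' * y) (x' * z - x * z') S3 Sp Sm"
    (is "?l = ?r")
proof (rule block_op_inject[OF n])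
  note car = spin_comb_carrier
  have rel: "block_op n (Sp * Sm - Sm * Sp) = block_op n (2 \<cdot>\<^sub>m S3)"
    "block_op n (S3 * Sp - Sp * S3) = block_op n Sp" "block_op n (S3 * Sm - Sm * S3) = block_op n (- Sm)"
    using assms by (simp_all add: spin_relations_def)
  have prod: "A * B \<in> carrier_mat n n" if "A \<in> carrier_mat n n" "B \<in> carrier_mat n n" for A B :: "complex mat"
    using that by (rule mult_carrier_mat)
  show "?l \<in> carrier_mat n n" by (intro minus_carrier_mat prod car)
  show "?r \<in> carrier_mat n n" by (rule car)
  show "block_op n ?l = block_op n ?r"
    unfolding block_op_minus[OF n prod[OF car car] prod[OF car car]] block_op_mult[OF n car car] block_op_spin_comb
    by (rule lin_op.comb_commutator)
      (use rel S3 Sp Sm in \<open>simp_all only: block_op_minus[OF n prod prod] block_op_mult[OF n] block_op_smult[OF n] block_op_uminus[OF n]\<close>)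
qed

lemma spin_comb_comb:
  "spin_comb x y z (spin_comb x1 y1 z1 S3 Sp Sm) (spin_comb x2 y2 z2 S3 Sp Sm) (spin_comb x3 y3 z3 S3 Sp Sm)
    = spin_comb (x * x1 + y * x2 + z * x3) (x * y1 + y * y2 + z * y3) (x * z1 + y * z2 + z * z3) S3 Sp Sm"
  using S3 Sp Sm by (intro eq_matI) (simp_all add: spin_comb_def algebra_simps)

lemma spin_comb_basis:
  "spin_comb 1 0 0 S3 Sp Sm = S3" "spin_comb 0 1 0 S3 Sp Sm = Sp" "spin_comb 0 0 1 S3 Sp Sm = Sm"
  using S3 Sp Sm by (auto simp: spin_comb_def intro!: eq_matI)

lemma spin_comb_invariant:
  assumes W: "VectorSpace.subspace class_ring W (module_vec TYPE(complex) n)"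
    and inv: "S3 *\<^sub>v w \<in> W" "Sp *\<^sub>v w \<in> W" "Sm *\<^sub>v w \<in> W" and w: "w \<in> W"
  shows "spin_comb x y z S3 Sp Sm *\<^sub>v w \<in> W"
proof -
  have sub: "submodule class_ring W (module_vec TYPE(complex) n)"
    using W by (simp add: VectorSpace.subspace_def)
  have add: "u + v \<in> W" if "u \<in> W" "v \<in> W" for u v
    using submodule.m_closed[OF sub that] by (simp add: module_vec_simps)
  have smult: "r \<cdot>\<^sub>v v \<in> W" if "v \<in> W" for r v
    using submodule.smult_closed[OF sub _ that, of r] by (simp add: module_vec_simps)
  have wc: "w \<in> carrier_vec n"
    using submodule.subset[OF sub] w by (auto simp: module_vec_simps)
  have "spin_comb x y z S3 Sp Sm *\<^sub>v w = x \<cdot>\<^sub>v (S3 *\<^sub>v w) + y \<cdot>\<^sub>v (Sp *\<^sub>v w) + z \<cdot>\<^sub>v (Sm *\<^sub>v w)"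
    using S3 Sp Sm wc unfolding spin_comb_def
    by (simp add: add_mult_distrib_mat_vec[of _ n n] smult_mat_mult_mat_vec[of _ n n])
  then show ?thesis using inv by (simp add: add smult)
qed

end

text \<open>
  Conjugation of the Lax operator by the matrix \<open>G = (b\<^sub>0, b\<^sub>1; - a\<^sub>1, a\<^sub>0)\<close> of determinant one
  replaces the spin operators by the following ones.
\<close>

definition rot_S3 where "rot_S3 a0 a1 b0 b1 = spin_comb (a0 * b0 - a1 * b1) (a0 * b1) (a1 * b0)"
definition rot_Sp where "rot_Sp a0 a1 = spin_comb (- 2 * a0 * a1) (a0\<^sup>2) (- (a1\<^sup>2))"
definition rot_Sm where "rot_Sm b0 b1 = spin_comb (- 2 * b0 * b1) (- (b1\<^sup>2)) (b0\<^sup>2)"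

text \<open>The rotation is an automorphism of sl(2). Being invertible, it leaves the invariant
  subspaces unchanged, so irreducibility is preserved.\<close>

lemma spin_irrep_rotate:
  assumes irrep: "spin_irrep d S3 Sp Sm" and det: "a0 * b0 + a1 * b1 = 1"
  shows "spin_irrep d (rot_S3 a0 a1 b0 b1 S3 Sp Sm) (rot_Sp a0 a1 S3 Sp Sm) (rot_Sm b0 b1 S3 Sp Sm)"
proof -
  define n where "n = d + 1"
  have n: "0 < n" by (simp add: n_def)
  have car: "S3 \<in> carrier_mat n n" "Sp \<in> carrier_mat n n" "Sm \<in> carrier_mat n n"
    and rel: "spin_relations S3 Sp Sm" and irr: "irreducible_action n {S3, Sp, Sm}"
    using irrep by (simp_all add: spin_irrep_def n_def)
  let ?S3 = "rot_S3 a0 a1 b0 b1 S3 Sp Sm" and ?Sp = "rot_Sp a0 a1 S3 Sp Sm"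
    and ?Sm = "rot_Sm b0 b1 S3 Sp Sm"
  have car': "?S3 \<in> carrier_mat n n" "?Sp \<in> carrier_mat n n" "?Sm \<in> carrier_mat n n"
    unfolding rot_S3_def rot_Sp_def rot_Sm_def using n car by (rule spin_comb_carrier)+
  note comm = spin_comb_commutator[OF n car rel]
  have smult: "r \<cdot>\<^sub>m spin_comb x y z S3 Sp Sm = spin_comb (r * x) (r * y) (r * z) S3 Sp Sm" for r x y z
    using car by (intro eq_matI) (simp_all add: spin_comb_def algebra_simps)
  have uminus: "- spin_comb x y z S3 Sp Sm = spin_comb (- x) (- y) (- z) S3 Sp Sm" for x y z
    using car by (intro eq_matI) (simp_all add: spin_comb_def algebra_simps)
  have cong: "spin_comb x y z S3 Sp Sm = spin_comb x' y' z' S3 Sp Sm"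
    if "x = x'" "y = y'" "z = z'" for x y z x' y' z' using that by simp
  have "spin_relations ?S3 ?Sp ?Sm"
    unfolding spin_relations_def rot_S3_def rot_Sp_def rot_Sm_def comm smult uminus
    by (intro conjI cong; insert det; Groebner_Basis.algebra)
  moreover have "irreducible_action n {?S3, ?Sp, ?Sm}"
  proof -
    have basis: "x = 1 \<Longrightarrow> y = 0 \<Longrightarrow> z = 0 \<Longrightarrow> S3 = spin_comb x y z S3 Sp Sm"
      "x = 0 \<Longrightarrow> y = 1 \<Longrightarrow> z = 0 \<Longrightarrow> Sp = spin_comb x y z S3 Sp Sm"
      "x = 0 \<Longrightarrow> y = 0 \<Longrightarrow> z = 1 \<Longrightarrow> Sm = spin_comb x y z S3 Sp Sm" for x y z
      by (simp_all only: spin_comb_basis[OF n car])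
    \<comment> \<open>The rotation belonging to the inverse of \<open>G\<close>: a0 and b0 change
      places, a1 and b1 change sign.\<close>
    have inv: "S3 = spin_comb (a0 * b0 - a1 * b1) (- (b0 * b1)) (- (a0 * a1)) ?S3 ?Sp ?Sm"
      "Sp = spin_comb (2 * a1 * b0) (b0\<^sup>2) (- (a1\<^sup>2)) ?S3 ?Sp ?Sm"
      "Sm = spin_comb (2 * a0 * b1) (- (b1\<^sup>2)) (a0\<^sup>2) ?S3 ?Sp ?Sm"
      unfolding rot_S3_def rot_Sp_def rot_Sm_def spin_comb_comb[OF n car]
      by - (rule basis; (simp add: power2_eq_square algebra_simps; fail | insert det, Groebner_Basis.algebra))+
    show ?thesis
      unfolding irreducible_action_def
    proof (intro conjI allI impI)
      fix W assume W: "VectorSpace.subspace class_ring W (module_vec TYPE(complex) n)"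
        and closed: "\<forall>X\<in>{?S3, ?Sp, ?Sm}. \<forall>w\<in>W. X *\<^sub>v w \<in> W"
      have "X *\<^sub>v w \<in> W" if X: "X \<in> {S3, Sp, Sm}" and w: "w \<in> W" for X w
      proof -
        obtain x y z where "X = spin_comb x y z ?S3 ?Sp ?Sm" using X inv by blast
        then show ?thesis
          using spin_comb_invariant[OF n car' W _ _ _ w] closed w by simp
      qed
      then show "W = {0\<^sub>v n} \<or> W = carrier_vec n"
        using irr W unfolding irreducible_action_def by blast
    qed (rule n)
  qed
  ultimately show ?thesis
    using car' by (simp add: spin_irrep_def n_def)
qed

subsection \<open>Site operators\<close>

lemma kronecker_list_Cons: "kronecker_list (A # As) = kronecker A (kronecker_list As)"
  by (simp add: kronecker_list_def)

lemma kronecker_list_carrier: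
  assumes "\<And>j. j \<in> set js \<Longrightarrow> f j \<in> carrier_mat (D j) (D j)"
  shows "kronecker_list (map f js) \<in> carrier_mat (\<Prod>j\<leftarrow>js. D j) (\<Prod>j\<leftarrow>js. D j)"
  using assms
proof (induction js)
  case (Cons j js)
  have "kronecker (f j) (kronecker_list (map f js)) \<in> carrier_mat (D j * (\<Prod>j\<leftarrow>js. D j)) (D j * (\<Prod>j\<leftarrow>js. D j))"
    using Cons by (intro kronecker_carrier) auto
  then show ?case by (simp only: list.map kronecker_list_Cons prod_list.Cons)
qed (simp add: kronecker_list_def)

lemma kronecker_list_mult:
  assumes "\<And>j. j \<in> set js \<Longrightarrow> f j \<in> carrier_mat (D j) (D j)"
    and "\<And>j. j \<in> set js \<Longrightarrow> h j \<in> carrier_mat (D j) (D j)"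
  shows "kronecker_list (map f js) * kronecker_list (map h js) = kronecker_list (map (\<lambda>j. f j * h j) js)"
  using assms
proof (induction js)
  case (Cons j js)
  have IH: "kronecker_list (map f js) * kronecker_list (map h js) = kronecker_list (map (\<lambda>j. f j * h j) js)"
    using Cons by simp
  have "f j \<in> carrier_mat (D j) (D j)" "h j \<in> carrier_mat (D j) (D j)" using Cons.prems by auto
  moreover have "kronecker_list (map f js) \<in> carrier_mat (\<Prod>j\<leftarrow>js. D j) (\<Prod>j\<leftarrow>js. D j)"
    "kronecker_list (map h js) \<in> carrier_mat (\<Prod>j\<leftarrow>js. D j) (\<Prod>j\<leftarrow>js. D j)"
    using Cons.prems by (intro kronecker_list_carrier; simp)+
  ultimately show ?case
    unfolding list.map kronecker_list_Cons IH[symmetric] by (intro kronecker_mult)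
qed (simp add: kronecker_list_def)

lemma kronecker_one: "kronecker (1\<^sub>m m) (1\<^sub>m n) = 1\<^sub>m (m * n)"
proof (rule eq_matI)
  fix i j assume "i < dim_row (1\<^sub>m (m * n) :: complex mat)" "j < dim_col (1\<^sub>m (m * n) :: complex mat)"
  then have i: "i < m * n" and j: "j < m * n" by auto
  have "i = j \<longleftrightarrow> i div n = j div n \<and> i mod n = j mod n"
    by (metis mult_div_mod_eq)
  then show "kronecker (1\<^sub>m m) (1\<^sub>m n) $$ (i, j) = 1\<^sub>m (m * n) $$ (i, j)"
    using i j div_mod_less[OF i] div_mod_less[OF j] by (auto simp: kronecker_def)
qed simp_all

lemma kronecker_list_one: "kronecker_list (map (\<lambda>j. 1\<^sub>m (D j)) js) = 1\<^sub>m (\<Prod>j\<leftarrow>js. D j)"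
proof (induction js)
  case (Cons j js)
  then show ?case by (simp only: list.map kronecker_list_Cons kronecker_one prod_list.Cons)
qed (simp add: kronecker_list_def)

lemma kronecker_add_left:
  "A \<in> carrier_mat m n \<Longrightarrow> B \<in> carrier_mat m n \<Longrightarrow> kronecker (A + B) C = kronecker A C + kronecker B C"
  by (rule eq_matI) (auto simp: kronecker_def div_mod_less algebra_simps)

lemma kronecker_add_right:
  assumes "B \<in> carrier_mat m n" "C \<in> carrier_mat m n"
  shows "kronecker A (B + C) = kronecker A B + kronecker A C"
  using assms by (intro eq_matI) (auto simp: kronecker_def div_mod_less algebra_simps)

lemma kronecker_smult_left: "kronecker (r \<cdot>\<^sub>m A) C = r \<cdot>\<^sub>m kronecker A C"
  by (rule eq_matI) (auto simp: kronecker_def div_mod_less algebra_simps)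

lemma kronecker_smult_right: "kronecker A (r \<cdot>\<^sub>m C) = r \<cdot>\<^sub>m kronecker A C"
  by (rule eq_matI) (auto simp: kronecker_def div_mod_less algebra_simps)

context
  fixes N :: nat and d :: "nat \<Rightarrow> nat"
begin

lemma space_dim_list: "space_dim N d = (\<Prod>j\<leftarrow>[1..<N + 1]. d j + 1)"
  unfolding space_dim_def by (simp only: prod.distinct_set_conv_list[symmetric] distinct_upt set_upt) 
    (rule prod.cong, auto)

lemma space_dim_pos: "0 < space_dim N d"
  unfolding space_dim_def by (intro prod_pos) simp

lemma site_op_carrier:
  assumes "A \<in> carrier_mat (d i + 1) (d i + 1)"
  shows "site_op N d i A \<in> carrier_mat (space_dim N d) (space_dim N d)"
  unfolding site_op_def space_dim_list using assms by (intro kronecker_list_carrier) auto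

lemma site_op_one: "site_op N d i (1\<^sub>m (d i + 1)) = 1\<^sub>m (space_dim N d)"
proof -
  have "(\<lambda>j. if j = i then 1\<^sub>m (d i + 1) else 1\<^sub>m (d j + 1)) = (\<lambda>j. 1\<^sub>m (d j + 1) :: complex mat)" by auto
  then show ?thesis unfolding site_op_def space_dim_list by (simp only: kronecker_list_one)
qed

lemma site_op_mult:
  assumes "A \<in> carrier_mat (d i + 1) (d i + 1)" "B \<in> carrier_mat (d i + 1) (d i + 1)"
  shows "site_op N d i (A * B) = site_op N d i A * site_op N d i B"
proof -
  have "site_op N d i A * site_op N d i B = kronecker_list (map (\<lambda>j. (if j = i then A else 1\<^sub>m (d j + 1)) *
      (if j = i then B else 1\<^sub>m (d j + 1))) [1..<N + 1])"
    unfolding site_op_def using assms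
    by (intro kronecker_list_mult[where D = "\<lambda>j. d j + 1"]) auto
  also have "(\<lambda>j. (if j = i then A else 1\<^sub>m (d j + 1)) * (if j = i then B else 1\<^sub>m (d j + 1)))
      = (\<lambda>j. if j = i then A * B else 1\<^sub>m (d j + 1))" by auto
  finally show ?thesis by (simp add: site_op_def)
qed

lemma site_op_commute:
  assumes "A \<in> carrier_mat (d i + 1) (d i + 1)" "B \<in> carrier_mat (d j + 1) (d j + 1)" "i \<noteq> j"
  shows "site_op N d i A * site_op N d j B = site_op N d j B * site_op N d i A"
proof -
  let ?A = "\<lambda>k. if k = i then A else 1\<^sub>m (d k + 1)" and ?B = "\<lambda>k. if k = j then B else 1\<^sub>m (d k + 1)"
  have AB: "?A k \<in> carrier_mat (d k + 1) (d k + 1)" "?B k \<in> carrier_mat (d k + 1) (d k + 1)" for k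
    using assms by auto
  have "?A k * ?B k = ?B k * ?A k" for k
  proof (cases "k = i")
    case True
    then have "?B k = 1\<^sub>m (d k + 1)" using assms(3) by simp
    then show ?thesis using AB(1)[of k] by (simp only: left_mult_one_mat right_mult_one_mat)
  next
    case False
    then have "?A k = 1\<^sub>m (d k + 1)" by simp
    then show ?thesis using AB(2)[of k] by (simp only: left_mult_one_mat right_mult_one_mat)
  qed
  then show ?thesis
    unfolding site_op_def kronecker_list_mult[of _ ?A "\<lambda>j. d j + 1" ?B, OF AB]
      kronecker_list_mult[of _ ?B "\<lambda>j. d j + 1" ?A, OF AB(2,1)] by (simp only:)
qed

text \<open>Exactly one tensor factor carries the sum. For a site outside the chain
  \<open>site_op\<close> is the identity, which is not additive, hence the restriction on
  \<open>i\<close>.\<close>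

lemma site_op_add:
  assumes "i \<in> {1..N}" "A \<in> carrier_mat (d i + 1) (d i + 1)" "B \<in> carrier_mat (d i + 1) (d i + 1)"
  shows "site_op N d i (A + B) = site_op N d i A + site_op N d i B"
proof -
  have single: "kronecker_list (map (\<lambda>j. if j = i then A + B else 1\<^sub>m (d j + 1)) js)
      = kronecker_list (map (\<lambda>j. if j = i then A else 1\<^sub>m (d j + 1)) js)
        + kronecker_list (map (\<lambda>j. if j = i then B else 1\<^sub>m (d j + 1)) js)"
    if "i \<in> set js" "distinct js" for js
    using that
  proof (induction js)
    case (Cons j js)
    show ?case
    proof (cases "j = i")
      case True
      then have "map (\<lambda>j. if j = i then X else 1\<^sub>m (d j + 1)) js = map (\<lambda>j. 1\<^sub>m (d j + 1)) js" for X :: "complex mat"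
        using Cons.prems by (intro map_cong) auto
      then show ?thesis using True assms(2,3)
        by (simp only: list.map kronecker_list_Cons if_True simp_thms kronecker_add_left)
    next
      case False
      have car: "kronecker_list (map (\<lambda>j. if j = i then X else 1\<^sub>m (d j + 1)) js)
          \<in> carrier_mat (\<Prod>j\<leftarrow>js. d j + 1) (\<Prod>j\<leftarrow>js. d j + 1)"
        if "X \<in> carrier_mat (d i + 1) (d i + 1)" for X
        using that by (intro kronecker_list_carrier) auto
      have IH: "kronecker_list (map (\<lambda>j. if j = i then A + B else 1\<^sub>m (d j + 1)) js)
        = kronecker_list (map (\<lambda>j. if j = i then A else 1\<^sub>m (d j + 1)) js)
          + kronecker_list (map (\<lambda>j. if j = i then B else 1\<^sub>m (d j + 1)) js)"
        using Cons False by auto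
      show ?thesis using False
        by (simp only: list.map kronecker_list_Cons if_False IH
            kronecker_add_right[OF car[OF assms(2)] car[OF assms(3)]])
    qed
  qed simp
  show ?thesis unfolding site_op_def by (rule single) (use assms(1) in auto)
qed

lemma site_op_smult:
  assumes "i \<in> {1..N}"
  shows "site_op N d i (r \<cdot>\<^sub>m A) = r \<cdot>\<^sub>m site_op N d i A"
proof -
  have single: "kronecker_list (map (\<lambda>j. if j = i then r \<cdot>\<^sub>m A else 1\<^sub>m (d j + 1)) js)
      = r \<cdot>\<^sub>m kronecker_list (map (\<lambda>j. if j = i then A else 1\<^sub>m (d j + 1)) js)"
    if "i \<in> set js" "distinct js" for js
    using that
  proof (induction js)
    case (Cons j js)
    show ?case
    proof (cases "j = i")
      case True
      then have "map (\<lambda>j. if j = i then X else 1\<^sub>m (d j + 1)) js = map (\<lambda>j. 1\<^sub>m (d j + 1)) js" for X :: "complex mat"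
        using Cons.prems by (intro map_cong) auto
      then show ?thesis using True
        by (simp only: list.map kronecker_list_Cons if_True simp_thms kronecker_smult_left)
    next
      case False
      have IH: "kronecker_list (map (\<lambda>j. if j = i then r \<cdot>\<^sub>m A else 1\<^sub>m (d j + 1)) js)
        = r \<cdot>\<^sub>m kronecker_list (map (\<lambda>j. if j = i then A else 1\<^sub>m (d j + 1)) js)"
        using Cons False by auto
      show ?thesis using False
        by (simp only: list.map kronecker_list_Cons if_False IH kronecker_smult_right)
    qed
  qed simp
  show ?thesis unfolding site_op_def by (rule single) (use assms in auto)
qed

end

subsection \<open>The spin chain inside the ring type\<close>

definition site_lin :: "nat \<Rightarrow> (nat \<Rightarrow> nat) \<Rightarrow> nat \<Rightarrow> complex mat \<Rightarrow> lin_op" where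
  "site_lin N d i A = block_op (space_dim N d) (site_op N d i A)"

definition spin_entry :: "'a \<Rightarrow> 'a \<Rightarrow> 'a \<Rightarrow> nat \<Rightarrow> nat \<Rightarrow> 'a::uminus" where
  "spin_entry S3 Sp Sm k l =
    (if k = 0 then if l = 0 then S3 else Sm else if l = 0 then Sp else - S3)"

definition site_entry ::
  "nat \<Rightarrow> (nat \<Rightarrow> nat) \<Rightarrow> (nat \<Rightarrow> complex mat) \<Rightarrow> (nat \<Rightarrow> complex mat) \<Rightarrow> (nat \<Rightarrow> complex mat) \<Rightarrow>
    nat \<Rightarrow> nat \<Rightarrow> nat \<Rightarrow> lin_op" where
  "site_entry N d S3 Sp Sm i =
    spin_entry (site_lin N d i (S3 i)) (site_lin N d i (Sp i)) (site_lin N d i (Sm i))"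

definition (in complex_algebra) trace_op ::
  "(nat \<Rightarrow> nat \<Rightarrow> complex) \<Rightarrow> (nat \<Rightarrow> nat \<Rightarrow> 'a) \<Rightarrow> 'a" where
  "trace_op v t = v 0 0 *\<^sub>C t 0 0 + v 0 1 *\<^sub>C t 1 0 + v 1 0 *\<^sub>C t 0 1 + v 1 1 *\<^sub>C t 1 1"

context
  fixes N :: nat and d :: "nat \<Rightarrow> nat"
begin

lemma
  assumes "i \<in> {1..N}" "A \<in> carrier_mat (d i + 1) (d i + 1)" "B \<in> carrier_mat (d i + 1) (d i + 1)"
  shows site_lin_add: "site_lin N d i (A + B) = site_lin N d i A + site_lin N d i B"
    and site_lin_mult: "site_lin N d i (A * B) = site_lin N d i A * site_lin N d i B"
  unfolding site_lin_def using assms space_dim_pos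
  by (simp_all only: site_op_add site_op_mult site_op_carrier block_op_add block_op_mult)

lemma site_lin_smult:
  assumes "i \<in> {1..N}" "A \<in> carrier_mat (d i + 1) (d i + 1)"
  shows "site_lin N d i (r \<cdot>\<^sub>m A) = scale_lin_op r (site_lin N d i A)"
  unfolding site_lin_def using assms space_dim_pos
  by (simp only: site_op_smult site_op_carrier block_op_smult)

lemma site_lin_one: "site_lin N d i (1\<^sub>m (d i + 1)) = 1"
  unfolding site_lin_def site_op_one by (rule block_op_one[OF space_dim_pos])

lemma site_lin_uminus:
  assumes "i \<in> {1..N}" "A \<in> carrier_mat (d i + 1) (d i + 1)"
  shows "site_lin N d i (- A) = - site_lin N d i A"
proof -
  have "- A = (- 1) \<cdot>\<^sub>m A" by (intro eq_matI) auto
  then show ?thesis using site_lin_smult[OF assms, of "- 1"] by simp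
qed

lemma site_lin_minus:
  assumes "i \<in> {1..N}" "A \<in> carrier_mat (d i + 1) (d i + 1)" "B \<in> carrier_mat (d i + 1) (d i + 1)"
  shows "site_lin N d i (A - B) = site_lin N d i A - site_lin N d i B"
proof -
  have "A - B = A + - B" using assms by (intro eq_matI) auto
  then show ?thesis using site_lin_add[OF assms(1,2), of "- B"] site_lin_uminus[OF assms(1,3)] assms(3)
    by simp
qed

lemma site_lin_zero:
  assumes "i \<in> {1..N}"
  shows "site_lin N d i (0\<^sub>m (d i + 1) (d i + 1)) = 0"
proof -
  have "0\<^sub>m (d i + 1) (d i + 1) = 0 \<cdot>\<^sub>m (1\<^sub>m (d i + 1) :: complex mat)" by (intro eq_matI) auto
  then show ?thesis using site_lin_smult[OF assms, of "1\<^sub>m (d i + 1)" 0] by simp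
qed

lemma site_lin_commute:
  assumes "A \<in> carrier_mat (d i + 1) (d i + 1)" "B \<in> carrier_mat (d j + 1) (d j + 1)" "i \<noteq> j"
  shows "site_lin N d i A * site_lin N d j B = site_lin N d j B * site_lin N d i A"
  using site_op_commute[OF assms, of N]
  unfolding site_lin_def block_op_mult[OF space_dim_pos site_op_carrier[of A d i, OF assms(1)] site_op_carrier[of B d j, OF assms(2)], symmetric]
    block_op_mult[OF space_dim_pos site_op_carrier[of B d j, OF assms(2)] site_op_carrier[of A d i, OF assms(1)], symmetric]
  by (rule arg_cong)

lemma site_lin_weight_mat:
  assumes "i \<in> {1..N}" "A \<in> carrier_mat (d i + 1) (d i + 1)"
  shows "site_lin N d i (weight_mat (d i) A k) = lin_op.weight_prod (d i) (site_lin N d i A) k"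
proof (induction k)
  case 0
  show ?case by (simp only: weight_mat.simps lin_op.weight_prod.simps site_lin_one)
next
  case (Suc k)
  have "weight (d i) k \<cdot>\<^sub>m 1\<^sub>m (d i + 1) - A \<in> carrier_mat (d i + 1) (d i + 1)"
    using assms(2) by (rule minus_carrier_mat)
  then show ?case
    unfolding weight_mat.simps lin_op.weight_prod.simps
    by (simp only: site_lin_mult[OF assms(1) weight_mat_carrier[OF assms(2)]] Suc
        site_lin_minus[OF assms(1) _ assms(2)] smult_carrier_mat one_carrier_mat
        site_lin_smult[OF assms(1)] site_lin_one)
qed

text \<open>Commutation relations pass through the homomorphism \<open>site_lin\<close>;
  irreducibility passes only as the vanishing of the weight product, which is a polynomial
  identity.\<close>

lemma spin_chain_site:
  assumes c: "c \<noteq> 0" and irrep: "\<And>i. i \<in> {1..N} \<Longrightarrow> spin_irrep (d i) (S3 i) (Sp i) (Sm i)"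
  shows "spin_chain scale_lin_op c (site_entry N d S3 Sp Sm) {1..N} d"
proof -
  have car: "S3 i \<in> carrier_mat (d i + 1) (d i + 1)" "Sp i \<in> carrier_mat (d i + 1) (d i + 1)"
      "Sm i \<in> carrier_mat (d i + 1) (d i + 1)" if "i \<in> {1..N}" for i
    using irrep[OF that] by (simp_all only: spin_irrep_def)
  have rel: "site_lin N d i (Sp i * Sm i - Sm i * Sp i) = site_lin N d i (2 \<cdot>\<^sub>m S3 i)"
      "site_lin N d i (S3 i * Sp i - Sp i * S3 i) = site_lin N d i (Sp i)"
      "site_lin N d i (S3 i * Sm i - Sm i * S3 i) = site_lin N d i (- Sm i)" if "i \<in> {1..N}" for i
    using irrep[OF that] by (simp_all only: spin_irrep_def spin_relations_def)
  have rel': "site_lin N d i (Sp i) * site_lin N d i (Sm i) - site_lin N d i (Sm i) * site_lin N d i (Sp i)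
        = scale_lin_op 2 (site_lin N d i (S3 i))"
      "site_lin N d i (S3 i) * site_lin N d i (Sp i) - site_lin N d i (Sp i) * site_lin N d i (S3 i)
        = site_lin N d i (Sp i)"
      "site_lin N d i (S3 i) * site_lin N d i (Sm i) - site_lin N d i (Sm i) * site_lin N d i (S3 i)
        = - site_lin N d i (Sm i)" if i: "i \<in> {1..N}" for i
  proof -
    note prod = mult_carrier_mat[of _ "d i + 1" "d i + 1" _ "d i + 1"]
    show "site_lin N d i (Sp i) * site_lin N d i (Sm i) - site_lin N d i (Sm i) * site_lin N d i (Sp i)
        = scale_lin_op 2 (site_lin N d i (S3 i))"
      using rel(1)[OF i] i car[OF i] by (simp only: site_lin_minus prod site_lin_mult site_lin_smult)
    show "site_lin N d i (S3 i) * site_lin N d i (Sp i) - site_lin N d i (Sp i) * site_lin N d i (S3 i)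
        = site_lin N d i (Sp i)"
      using rel(2)[OF i] i car[OF i] by (simp only: site_lin_minus prod site_lin_mult)
    show "site_lin N d i (S3 i) * site_lin N d i (Sm i) - site_lin N d i (Sm i) * site_lin N d i (S3 i)
        = - site_lin N d i (Sm i)"
      using rel(3)[OF i] i car[OF i] by (simp only: site_lin_minus prod site_lin_mult site_lin_uminus)
  qed
  have two: "scale_lin_op 2 X = X + X" for X
    using lin_op.scale_left_distrib[of 1 1 X] by simp
  show ?thesis
  proof
    fix i j k l p q :: nat
    assume ij: "i \<in> {1..N}" "j \<in> {1..N}" "i \<noteq> j"
    note comm = site_lin_commute[of _ i _ j, OF _ _ ij(3)]
    show "site_entry N d S3 Sp Sm i k l * site_entry N d S3 Sp Sm j p q
        = site_entry N d S3 Sp Sm j p q * site_entry N d S3 Sp Sm i k l"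
      using car[OF ij(1)] car[OF ij(2)]
      by (simp add: site_entry_def spin_entry_def comm del: One_nat_def add_Suc_right)
  next
    fix i assume i: "i \<in> {1..N}"
    show "lin_op.weight_prod (d i) (site_entry N d S3 Sp Sm i 0 0) (Suc (d i)) = 0"
      using site_lin_weight_mat[OF i car(1)[OF i], of "Suc (d i)"]
        spin_irrep_weight_mat[OF irrep[OF i]] site_lin_zero[OF i]
      by (simp add: site_entry_def spin_entry_def del: weight_mat.simps lin_op.weight_prod.simps)
  qed (use c rel' in \<open>simp_all add: site_entry_def spin_entry_def two\<close>)
qed

lemma lax_carrier:
  assumes "i \<in> {1..N}" "S3 i \<in> carrier_mat (d i + 1) (d i + 1)" "Sp i \<in> carrier_mat (d i + 1) (d i + 1)"
    "Sm i \<in> carrier_mat (d i + 1) (d i + 1)"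
  shows "lax c N d S3 Sp Sm i x k l \<in> carrier_mat (space_dim N d) (space_dim N d)"
proof -
  note car = site_op_carrier[of _ d i N]
  show ?thesis
    using car[OF assms(2)] car[OF assms(3)] car[OF assms(4)] by (simp add: lax_def Let_def minus_carrier_mat)
qed

lemma block_op_lax:
  assumes "i \<in> {1..N}" "S3 i \<in> carrier_mat (d i + 1) (d i + 1)" "Sp i \<in> carrier_mat (d i + 1) (d i + 1)"
    "Sm i \<in> carrier_mat (d i + 1) (d i + 1)" "k < 2" "l < 2"
  shows "block_op (space_dim N d) (lax c N d S3 Sp Sm i (x - \<theta> i) k l)
    = lin_op.lax_op c \<theta> (site_entry N d S3 Sp Sm) i x k l"
proof -
  note car = site_op_carrier[of _ d i N]
  have "k = 0 \<or> k = 1" "l = 0 \<or> l = 1" using assms by auto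
  then show ?thesis
    using car[OF assms(2)] car[OF assms(3)] car[OF assms(4)]
    by (elim disjE) (simp_all add: lax_def Let_def lin_op.lax_op_def site_entry_def spin_entry_def
        site_lin_def block_op_simps space_dim_pos)
qed

lemma block_op_monodromy:
  assumes car: "\<And>i. i \<in> {1..N} \<Longrightarrow> S3 i \<in> carrier_mat (d i + 1) (d i + 1)"
      "\<And>i. i \<in> {1..N} \<Longrightarrow> Sp i \<in> carrier_mat (d i + 1) (d i + 1)"
      "\<And>i. i \<in> {1..N} \<Longrightarrow> Sm i \<in> carrier_mat (d i + 1) (d i + 1)"
    and kl: "k < 2" "l < 2"
  shows "monodromy c N d \<theta> S3 Sp Sm x k l \<in> carrier_mat (space_dim N d) (space_dim N d) \<and>
    block_op (space_dim N d) (monodromy c N d \<theta> S3 Sp Sm x k l)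
    = lin_op.mono_op c \<theta> (site_entry N d S3 Sp Sm) [1..<N + 1] x k l"
proof -
  let ?n = "space_dim N d"
  let ?M = "\<lambda>js. foldr op_mat2_mult (map (\<lambda>i. lax c N d S3 Sp Sm i (x - \<theta> i)) js) (op_mat2_one ?n)"
  have "?M js k l \<in> carrier_mat ?n ?n \<and>
      block_op ?n (?M js k l) = lin_op.mono_op c \<theta> (site_entry N d S3 Sp Sm) js x k l"
    if "set js \<subseteq> {1..N}" "k < 2" "l < 2" for js k l
    using that
  proof (induction js arbitrary: k l)
    case Nil
    then show ?case
      by (simp add: op_mat2_one_def block_op_one[OF space_dim_pos] block_op_zero[OF space_dim_pos])
  next
    case (Cons i js)
    have i: "i \<in> {1..N}" using Cons.prems by simp
    have IH: "?M js p l \<in> carrier_mat ?n ?n"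
        "block_op ?n (?M js p l) = lin_op.mono_op c \<theta> (site_entry N d S3 Sp Sm) js x p l" if "p < 2" for p
      using Cons.IH[of p l] Cons.prems that by auto
    have L: "lax c N d S3 Sp Sm i (x - \<theta> i) k p \<in> carrier_mat ?n ?n" for p
      by (rule lax_carrier[where ?S3.0 = S3 and Sp = Sp and Sm = Sm, OF i car(1)[OF i] car(2)[OF i] car(3)[OF i]])
    note bL = block_op_lax[where ?S3.0 = S3 and Sp = Sp and Sm = Sm, OF i car(1)[OF i] car(2)[OF i] car(3)[OF i] Cons.prems(2)]
    have M: "?M (i # js) k l = lax c N d S3 Sp Sm i (x - \<theta> i) k 0 * ?M js 0 l
        + lax c N d S3 Sp Sm i (x - \<theta> i) k 1 * ?M js 1 l"
      by (simp add: op_mat2_mult_def)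
    have P: "lax c N d S3 Sp Sm i (x - \<theta> i) k p * ?M js p l \<in> carrier_mat ?n ?n" if "p < 2" for p
      by (rule mult_carrier_mat[OF L IH(1)[OF that]])
    have "?M (i # js) k l \<in> carrier_mat ?n ?n"
      unfolding M by (intro add_carrier_mat P) auto
    moreover have "block_op ?n (?M (i # js) k l)
        = lin_op.lax_op c \<theta> (site_entry N d S3 Sp Sm) i x k 0 * lin_op.mono_op c \<theta> (site_entry N d S3 Sp Sm) js x 0 l
        + lin_op.lax_op c \<theta> (site_entry N d S3 Sp Sm) i x k 1 * lin_op.mono_op c \<theta> (site_entry N d S3 Sp Sm) js x 1 l"
      unfolding M
      by (simp only: block_op_add[OF space_dim_pos P P] block_op_mult[OF space_dim_pos L IH(1)] bL IH(2)
          pos2 one_less_numeral_iff semiring_norm zero_less_numeral)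
    ultimately show ?case by (simp add: numeral_2_eq_2)
  qed
  moreover have "set [1..<N + 1] \<subseteq> {1..N}" by auto
  ultimately show ?thesis unfolding monodromy_def using kl by blast
qed

end

section \<open>Reduction of a singular twist to the upper left entry\<close>

text \<open>The four entries of G s = s' G, where G has rows (b0, b1) and (-a1, a0) and the spin
  matrices have rows (s, m), (p, -s) and (S, M), (P, -S).\<close>

lemma (in complex_algebra) rotation_intertwine:
  fixes s p m :: 'a
  assumes det: "a0 * b0 + a1 * b1 = 1"
  defines "S \<equiv> (a0 * b0 - a1 * b1) *\<^sub>C s + (a0 * b1) *\<^sub>C p + (a1 * b0) *\<^sub>C m"
    and "P \<equiv> (- 2 * a0 * a1) *\<^sub>C s + a0\<^sup>2 *\<^sub>C p + (- (a1\<^sup>2)) *\<^sub>C m"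
    and "M \<equiv> (- 2 * b0 * b1) *\<^sub>C s + (- (b1\<^sup>2)) *\<^sub>C p + b0\<^sup>2 *\<^sub>C m"
  shows "b0 *\<^sub>C s + b1 *\<^sub>C p = b0 *\<^sub>C S + (- a1) *\<^sub>C M"
    and "b0 *\<^sub>C m + b1 *\<^sub>C (- s) = b1 *\<^sub>C S + a0 *\<^sub>C M"
    and "(- a1) *\<^sub>C s + a0 *\<^sub>C p = b0 *\<^sub>C P + (- a1) *\<^sub>C (- S)"
    and "(- a1) *\<^sub>C m + a0 *\<^sub>C (- s) = b1 *\<^sub>C P + a0 *\<^sub>C (- S)"
proof -
  have comb: "r *\<^sub>C (x *\<^sub>C s + y *\<^sub>C p + z *\<^sub>C m) + t *\<^sub>C (x' *\<^sub>C s + y' *\<^sub>C p + z' *\<^sub>C m) =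
      x'' *\<^sub>C s + y'' *\<^sub>C p + z'' *\<^sub>C m"
    if "r * x + t * x' = x''" "r * y + t * y' = y''" "r * z + t * z' = z''" for r t x y z x' y' z' x'' y'' z''
    unfolding that[symmetric] by (simp add: algebra_simps)
  have "b0 *\<^sub>C S + (- a1) *\<^sub>C M = b0 *\<^sub>C s + b1 *\<^sub>C p + 0 *\<^sub>C m"
    unfolding S_def M_def by (rule comb; (simp add: power2_eq_square algebra_simps; fail | insert det, Groebner_Basis.algebra))
  then show "b0 *\<^sub>C s + b1 *\<^sub>C p = b0 *\<^sub>C S + (- a1) *\<^sub>C M" by simp
  have "b1 *\<^sub>C S + a0 *\<^sub>C M = (- b1) *\<^sub>C s + 0 *\<^sub>C p + b0 *\<^sub>C m"
    unfolding S_def M_def by (rule comb; (simp add: power2_eq_square algebra_simps; fail | insert det, Groebner_Basis.algebra))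
  then show "b0 *\<^sub>C m + b1 *\<^sub>C (- s) = b1 *\<^sub>C S + a0 *\<^sub>C M" by (simp add: algebra_simps)
  have "b0 *\<^sub>C P + a1 *\<^sub>C S = (- a1) *\<^sub>C s + a0 *\<^sub>C p + 0 *\<^sub>C m"
    unfolding S_def P_def by (rule comb; (simp add: power2_eq_square algebra_simps; fail | insert det, Groebner_Basis.algebra))
  then show "(- a1) *\<^sub>C s + a0 *\<^sub>C p = b0 *\<^sub>C P + (- a1) *\<^sub>C (- S)" by simp
  have "b1 *\<^sub>C P + (- a0) *\<^sub>C S = (- a0) *\<^sub>C s + 0 *\<^sub>C p + (- a1) *\<^sub>C m"
    unfolding S_def P_def by (rule comb; (simp add: power2_eq_square algebra_simps; fail | insert det, Groebner_Basis.algebra))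
  then show "(- a1) *\<^sub>C m + a0 *\<^sub>C (- s) = b1 *\<^sub>C P + a0 *\<^sub>C (- S)" by (simp add: algebra_simps)
qed

text \<open>A singular matrix with nonzero trace has rank one, so it is \<tau> times a column a
  times a row b; the trace forces their pairing to be 1.\<close>

lemma rank_one_2:
  fixes v :: "nat \<Rightarrow> nat \<Rightarrow> complex"
  assumes det: "v 0 0 * v 1 1 = v 0 1 * v 1 0" and tr: "v 0 0 + v 1 1 = \<tau>" "\<tau> \<noteq> 0"
  obtains a0 a1 b0 b1 where "a0 * b0 + a1 * b1 = 1" "v 0 0 = \<tau> * (a0 * b0)" "v 0 1 = \<tau> * (a0 * b1)"
    "v 1 0 = \<tau> * (a1 * b0)" "v 1 1 = \<tau> * (a1 * b1)"
proof (cases "v 0 0 = 0")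
  case False
  show ?thesis
  \<comment> \<open>The witnesses are listed in the order a0, b0, a1, b1.\<close>
  proof (rule that[of 1 "v 0 0 / \<tau>" "v 1 0 / v 0 0" "v 0 1 / \<tau>"])
    show "1 * (v 0 0 / \<tau>) + v 1 0 / v 0 0 * (v 0 1 / \<tau>) = 1"
    proof -
      have "v 0 0 * v 0 0 + v 0 1 * v 1 0 = v 0 0 * \<tau>"
        unfolding tr(1)[symmetric] by (simp only: distrib_left det)
      then show ?thesis using False tr(2) by (simp add: field_simps)
    qed
  qed (use False tr det in \<open>simp_all add: field_simps\<close>)
next
  case True
  then have v: "v 1 1 = \<tau>" "v 0 1 * v 1 0 = 0" using tr det by auto
  show ?thesis
    by (rule that[of "v 0 1 / \<tau>" "v 1 0 / \<tau>" 1 1]) (use True v tr in \<open>simp_all add: field_simps\<close>)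
qed

lemma eigen_prod_eq_F:
  assumes "spin_chain scale c s I d" "c \<noteq> 0"
  shows "spin_chain.eigen_prod c \<theta> d [1..<N + 1] x = F c N d \<theta> x"
proof -
  interpret spin_chain scale c \<theta> s I d by (rule assms(1))
  have factor: "(x - \<theta> i) / c + 1 / 2 + weight (d i) k
      = (x - \<theta> i + c * (of_nat (d i) / 2 - of_nat k + 1 / 2)) / c" for i k
    using assms(2) by (simp add: weight_def field_simps)
  have "eigen_prod [1..<N + 1] x = (\<Prod>i\<in>{1..<N + 1}. \<Prod>k<Suc (d i). (x - \<theta> i) / c + 1 / 2 + weight (d i) k)"
    unfolding eigen_prod_def by (simp only: prod.distinct_set_conv_list[symmetric] distinct_upt set_upt)
  also have "\<dots> = F c N d \<theta> x"
    unfolding F_def factor by (intro prod.cong) auto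
  finally show ?thesis .
qed

definition nu_lin ::
  "complex \<Rightarrow> nat \<Rightarrow> (nat \<Rightarrow> nat) \<Rightarrow> (nat \<Rightarrow> complex) \<Rightarrow> (nat \<Rightarrow> complex mat) \<Rightarrow> (nat \<Rightarrow> complex mat) \<Rightarrow>
    (nat \<Rightarrow> complex mat) \<Rightarrow> (nat \<Rightarrow> nat \<Rightarrow> complex) \<Rightarrow> complex \<Rightarrow> lin_op" where
  "nu_lin c N d \<theta> S3 Sp Sm v x =
    lin_op.trace_op v (lin_op.mono_op c \<theta> (site_entry N d S3 Sp Sm) [1..<N + 1] x)"

context
  fixes c :: complex and N :: nat and d :: "nat \<Rightarrow> nat" and \<theta> :: "nat \<Rightarrow> complex"
    and S3 Sp Sm :: "nat \<Rightarrow> complex mat" and S :: nat and u :: "nat \<Rightarrow> complex" and z :: complex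
  assumes c: "c \<noteq> 0" and irrep: "\<And>i. i \<in> {1..N} \<Longrightarrow> spin_irrep (d i) (S3 i) (Sp i) (Sm i)"
    and S: "S = (\<Sum>i = 1..N. d i)" and inj: "inj_on u {1..S}" and z: "z \<notin> u ` {1..S}"
begin

abbreviation "nu \<equiv> nu_lin c N d \<theta> S3 Sp Sm"

lemma defect_nonzero_trace:
  assumes det: "v 0 0 * v 1 1 = v 0 1 * v 1 0" and tr: "v 0 0 + v 1 1 = \<tau>" "\<tau> \<noteq> 0"
  shows "lin_op.transfer_defect c (F c N d \<theta>) S u z \<tau> (nu v) = 0"
proof -
  obtain a0 a1 b0 b1 where ab: "a0 * b0 + a1 * b1 = 1" and v: "v 0 0 = \<tau> * (a0 * b0)"
    "v 0 1 = \<tau> * (a0 * b1)" "v 1 0 = \<tau> * (a1 * b0)" "v 1 1 = \<tau> * (a1 * b1)"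
    using rank_one_2[of v \<tau>, OF det tr] by metis
  define S3' where "S3' i = rot_S3 a0 a1 b0 b1 (S3 i) (Sp i) (Sm i)" for i
  define Sp' where "Sp' i = rot_Sp a0 a1 (S3 i) (Sp i) (Sm i)" for i
  define Sm' where "Sm' i = rot_Sm b0 b1 (S3 i) (Sp i) (Sm i)" for i
  let ?s = "site_entry N d S3 Sp Sm" and ?s' = "site_entry N d S3' Sp' Sm'" and ?js = "[1..<N + 1]"
  have chain: "spin_chain scale_lin_op c ?s' {1..N} d"
    unfolding S3'_def Sp'_def Sm'_def by (intro spin_chain_site c spin_irrep_rotate irrep ab)
  interpret sc: spin_chain scale_lin_op c \<theta> ?s' "{1..N}" d by (rule chain)
  \<comment> \<open>The first row is b and the second row annihilates the column a, so contracting G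
    T = T' G with a on the right isolates the entry (0, 0) of T'.\<close>
  define G where "G k l = (if k = 0 then if l = 0 then b0 else b1 else if l = 0 then - a1 else a0)" for k l :: nat
  have "(\<Sum>p<2. scale_lin_op (G k p) (?s i p l)) = (\<Sum>p<2. scale_lin_op (G p l) (?s' i k p))"
    if i: "i \<in> set ?js" and kl: "k < 2" "l < 2" for i k l
  proof -
    have i: "i \<in> {1..N}" using i by auto
    have car: "S3 i \<in> carrier_mat (d i + 1) (d i + 1)" "Sp i \<in> carrier_mat (d i + 1) (d i + 1)"
        "Sm i \<in> carrier_mat (d i + 1) (d i + 1)"
      using irrep[OF i] by (simp_all only: spin_irrep_def)
    have comb: "site_lin N d i (spin_comb r y t (S3 i) (Sp i) (Sm i))
        = scale_lin_op r (site_lin N d i (S3 i)) + scale_lin_op y (site_lin N d i (Sp i))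
          + scale_lin_op t (site_lin N d i (Sm i))" for r y t
      unfolding spin_comb_def using i car
      by (simp only: site_lin_add site_lin_smult smult_carrier_mat add_carrier_mat)
    note rot = lin_op.rotation_intertwine[OF ab, where s = "site_lin N d i (S3 i)"
        and p = "site_lin N d i (Sp i)" and m = "site_lin N d i (Sm i)"]
    have sum2: "(\<Sum>p<2. f p) = f 0 + f 1" for f :: "nat \<Rightarrow> lin_op" by (simp add: numeral_2_eq_2)
    have entries: "?s i 0 0 = site_lin N d i (S3 i)" "?s i 0 1 = site_lin N d i (Sm i)"
        "?s i 1 0 = site_lin N d i (Sp i)" "?s i 1 1 = - site_lin N d i (S3 i)"
        "?s' i 0 0 = site_lin N d i (S3' i)" "?s' i 0 1 = site_lin N d i (Sm' i)"
        "?s' i 1 0 = site_lin N d i (Sp' i)" "?s' i 1 1 = - site_lin N d i (S3' i)"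
        "G 0 0 = b0" "G 0 1 = b1" "G 1 0 = - a1" "G 1 1 = a0"
      by (simp_all add: site_entry_def spin_entry_def G_def)
    have "k = 0 \<or> k = 1" "l = 0 \<or> l = 1" using kl by auto
    then show ?thesis
      by (elim disjE)
        (simp_all only: sum2 entries S3'_def Sp'_def Sm'_def rot_S3_def rot_Sp_def rot_Sm_def comb,
          (rule rot)+)
  qed
  note intertwine = lin_op.mono_op_intertwine[of ?js G ?s ?s', OF this]
  have "nu v x = scale_lin_op \<tau> (sc.T ?js x 0 0)" for x
  proof -
    let ?T = "lin_op.mono_op c \<theta> ?s ?js x" and ?T' = "sc.T ?js x"
    have T0: "scale_lin_op b0 (?T 0 0) + scale_lin_op b1 (?T 1 0)
        = scale_lin_op b0 (?T' 0 0) + scale_lin_op (- a1) (?T' 0 1)"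
      using intertwine[of 0 0 c \<theta> x] by (simp add: numeral_2_eq_2 G_def del: upt_Suc)
    have T1: "scale_lin_op b0 (?T 0 1) + scale_lin_op b1 (?T 1 1)
        = scale_lin_op b1 (?T' 0 0) + scale_lin_op a0 (?T' 0 1)"
      using intertwine[of 0 1 c \<theta> x] by (simp add: numeral_2_eq_2 G_def del: upt_Suc)
    \<comment> \<open>The trace is regrouped as b T a. After \<open>T0\<close> and
      \<open>T1\<close>, the contributions of the entry (0, 1) of T' are -a0 a1 and a1 a0, and they
      cancel.\<close>
    have "nu v x = scale_lin_op \<tau> (scale_lin_op a0 (scale_lin_op b0 (?T 0 0) + scale_lin_op b1 (?T 1 0))
        + scale_lin_op a1 (scale_lin_op b0 (?T 0 1) + scale_lin_op b1 (?T 1 1)))"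
      unfolding nu_lin_def lin_op.trace_op_def v
      by (simp only: lin_op.scale_right_distrib lin_op.scale_scale add.assoc add.left_commute)
    also have "\<dots> = scale_lin_op \<tau> (scale_lin_op (a0 * b0 + a1 * b1) (?T' 0 0))"
      unfolding T0 T1 by (simp add: lin_op.scale_right_distrib lin_op.scale_left_distrib
          lin_op.scale_right_diff_distrib mult.commute[of a1 a0] del: upt_Suc)
    finally show ?thesis by (simp add: ab)
  qed
  then have nu: "nu v = (\<lambda>x. scale_lin_op \<tau> (sc.T ?js x 0 0))" by (rule ext)
  have "F c N d \<theta> = sc.eigen_prod ?js"
    using eigen_prod_eq_F[OF chain c] by (intro ext) (rule sym)
  moreover have "S = sum_list (map d ?js)"
    unfolding S by (simp only: sum.distinct_set_conv_list[symmetric] distinct_upt set_upt) (rule sum.cong, auto)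
  ultimately show ?thesis
    unfolding nu using tr(2) inj z by (simp only:) (intro sc.transfer_defect_mono; auto)
qed

lemma defect:
  assumes det: "v 0 0 * v 1 1 = v 0 1 * v 1 0"
  shows "lin_op.transfer_defect c (F c N d \<theta>) S u z (v 0 0 + v 1 1) (nu v) = 0"
proof (cases "v 0 0 + v 1 1 = 0")
  case False
  then show ?thesis using det by (intro defect_nonzero_trace) auto
next
  case tr: True
  \<comment> \<open>A direction that keeps the matrix singular and changes the trace. If
    \<open>v 0 1 = 0\<close>, the diagonal vanishes and a unit in the upper left corner works.
    Otherwise t times the first row is added to the second, a row operation whose trace is t times
    \<open>v 0 1\<close>.\<close>
  obtain W :: "nat \<Rightarrow> nat \<Rightarrow> complex" where W: "W 0 0 + W 1 1 \<noteq> 0"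
    "\<And>t. (v 0 0 + t * W 0 0) * (v 1 1 + t * W 1 1) = (v 0 1 + t * W 0 1) * (v 1 0 + t * W 1 0)"
  proof (cases "v 0 1 = 0")
    case True
    then have "v 0 0 = 0" "v 1 1 = 0" using tr det by (auto simp: add_eq_0_iff)
    with True show ?thesis
      by (intro that[of "\<lambda>k l. of_bool (k = 0 \<and> l = 0)"]) auto
  next
    case False
    with det show ?thesis
      by (intro that[of "\<lambda>k l. if k = 0 then 0 else v 0 l"]) (auto simp: algebra_simps)
  qed
  have lin: "nu (\<lambda>k l. v k l + t * W k l) x = nu v x + scale_lin_op t (nu W x)" for t x
    unfolding nu_lin_def lin_op.trace_op_def
    by (simp add: lin_op.scale_left_distrib lin_op.scale_right_distrib add_ac del: upt_Suc mult_cancel_left)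
  have "lin_op.transfer_defect c (F c N d \<theta>) S u z (t * (W 0 0 + W 1 1))
      (\<lambda>x. nu v x + scale_lin_op t (nu W x)) = 0" if "t \<noteq> 0" for t
  proof -
    have "(v 0 0 + t * W 0 0) + (v 1 1 + t * W 1 1) = t * (W 0 0 + W 1 1)"
      using tr by (simp add: algebra_simps)
    then show ?thesis
      using defect_nonzero_trace[of "\<lambda>k l. v k l + t * W k l" "t * (W 0 0 + W 1 1)"] W that
      unfolding lin[abs_def] by simp
  qed
  then show ?thesis unfolding tr by (rule lin_op.transfer_defect_zero_trace)
qed

end

section \<open>Return to matrices\<close>

lemma det_2_zero:
  assumes "V \<in> carrier_mat 2 2" "det V = (0 :: complex)"
  shows "V $$ (0, 0) * V $$ (1, 1) = V $$ (0, 1) * V $$ (1, 0)"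
proof -
  have "det V = (\<Sum>j<2. V $$ (0, j) * cofactor V 0 j)"
    using assms(1) by (intro laplace_expansion_row) auto
  also have "\<dots> = V $$ (0, 0) * V $$ (1, 1) - V $$ (0, 1) * V $$ (1, 0)"
    using assms(1) by (simp add: numeral_2_eq_2 cofactor_def det_single mat_delete_def)
  finally show ?thesis using assms(2) by simp
qed

lemma op_prod_carrier:
  "(\<And>A. A \<in> set As \<Longrightarrow> A \<in> carrier_mat n n) \<Longrightarrow> op_prod n As \<in> carrier_mat n n"
  by (induction As) (auto simp: op_prod_def intro!: mult_carrier_mat)

lemma block_op_op_prod:
  assumes "0 < n" "\<And>A. A \<in> set As \<Longrightarrow> A \<in> carrier_mat n n"
  shows "block_op n (op_prod n As) = prod_list (map (block_op n) As)"
  using assms(2)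
proof (induction As)
  case Nil
  show ?case by (simp add: op_prod_def block_op_one[OF assms(1)])
next
  case (Cons A As)
  have "block_op n (op_prod n (A # As)) = block_op n (A * op_prod n As)" by (simp add: op_prod_def)
  also have "\<dots> = block_op n A * block_op n (op_prod n As)"
    using Cons.prems by (intro block_op_mult[OF assms(1)] op_prod_carrier) auto
  finally show ?case using Cons by simp
qed

text \<open>Translates the sum of the matrix ring, which lives on a carrier, into an ordinary sum of
  the ring type.\<close>

lemma block_op_finsum:
  fixes f :: "'i \<Rightarrow> complex mat"
  assumes "0 < n" "finite I" "\<And>i. i \<in> I \<Longrightarrow> f i \<in> carrier_mat n n"
  shows "finsum (ring_mat TYPE(complex) n ()) f I \<in> carrier_mat n n \<and>
    block_op n (finsum (ring_mat TYPE(complex) n ()) f I) = (\<Sum>i\<in>I. block_op n (f i))"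
proof -
  interpret R: ring "ring_mat TYPE(complex) n ()" by (rule ring_mat)
  show ?thesis
    using assms(2,3)
  proof (induction I rule: finite_induct)
    case empty
    show ?case by (simp add: ring_mat_simps block_op_zero[OF assms(1)])
  next
    case (insert i I)
    have "finsum (ring_mat TYPE(complex) n ()) f (insert i I) = f i + finsum (ring_mat TYPE(complex) n ()) f I"
      using insert.hyps insert.prems by (subst R.finsum_insert) (auto simp: ring_mat_simps)
    then show ?case using insert assms(1) by (simp add: block_op_add)
  qed
qed

theorem theorem4p5:
  fixes c z :: complex
    and N S :: nat
    and d :: "nat \<Rightarrow> nat"
    and \<theta> u :: "nat \<Rightarrow> complex"
    and S3 Sp Sm :: "nat \<Rightarrow> complex mat"
    and V :: "complex mat"
    and \<nu> :: "complex \<Rightarrow> complex mat"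
  assumes "c \<noteq> 0"
    and "N \<ge> 1"
    and "\<And>i. i \<in> {1..N} \<Longrightarrow> d i \<ge> 1"
    and "\<And>i. i \<in> {1..N} \<Longrightarrow> spin_irrep (d i) (S3 i) (Sp i) (Sm i)"
    and "V \<in> carrier_mat 2 2"
    and "det V = 0"
    and "\<And>x. \<nu> x = transfer_matrix c N d \<theta> S3 Sp Sm V x"
    and "S = (\<Sum>i = 1..N. d i)"
    and "inj_on u {1..S}"
    and "z \<notin> u ` {1..S}"
  shows "\<nu> z * op_prod (space_dim N d) (map (\<lambda>j. \<nu> (u j)) [1..<S + 1]) =
    mat_trace V \<cdot>\<^sub>m
      ((F c N d \<theta> z * (\<Prod>j = 1..S. g c z (u j))) \<cdot>\<^sub>m
          op_prod (space_dim N d) (map (\<lambda>j. \<nu> (u j)) [1..<S + 1])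
       + (\<Oplus>\<^bsub>ring_mat TYPE(complex) (space_dim N d) ()\<^esub> i\<in>{1..S}.
            (g c (u i) z * F c N d \<theta> (u i) * (\<Prod>j\<in>{1..S} - {i}. g c (u i) (u j))) \<cdot>\<^sub>m
              (\<nu> z * op_prod (space_dim N d)
                       (map (\<lambda>j. \<nu> (u j)) (filter (\<lambda>j. j \<noteq> i) [1..<S + 1])))))"
    (is "_ = _ \<cdot>\<^sub>m (?r \<cdot>\<^sub>m _ + finsum _ (\<lambda>i. ?c i \<cdot>\<^sub>m ?Q i) _)")
proof -
  define n where "n = space_dim N d"
  have n: "0 < n" unfolding n_def by (rule space_dim_pos)
  define v where "v k l = V $$ (k, l)" for k l
  define nu where "nu = nu_lin c N d \<theta> S3 Sp Sm v"
  have car: "S3 i \<in> carrier_mat (d i + 1) (d i + 1)" "Sp i \<in> carrier_mat (d i + 1) (d i + 1)"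
      "Sm i \<in> carrier_mat (d i + 1) (d i + 1)" if "i \<in> {1..N}" for i
    using assms(4)[OF that] by (simp_all only: spin_irrep_def)
  note mono = block_op_monodromy[of N S3 d Sp Sm, OF car, folded n_def]
  have \<nu>: "\<nu> x \<in> carrier_mat n n" "block_op n (\<nu> x) = nu x" for x
    unfolding assms(7) transfer_matrix_def Let_def nu_def nu_lin_def lin_op.trace_op_def v_def
    using mono[of 0 0 c \<theta> x] mono[of 1 0 c \<theta> x] mono[of 0 1 c \<theta> x] mono[of 1 1 c \<theta> x]
    by (simp_all add: block_op_add[OF n] block_op_smult[OF n] del: upt_Suc)
  have prod: "op_prod n (map (\<lambda>j. \<nu> (u j)) js) \<in> carrier_mat n n"
    "block_op n (op_prod n (map (\<lambda>j. \<nu> (u j)) js)) = prod_list (map (\<lambda>j. nu (u j)) js)" for js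
    using op_prod_carrier[of "map (\<lambda>j. \<nu> (u j)) js" n] block_op_op_prod[of n "map (\<lambda>j. \<nu> (u j)) js"] n \<nu>
    by (auto simp: comp_def)
  have tr: "mat_trace V = v 0 0 + v 1 1"
    using assms(5) by (simp add: mat_trace_def v_def numeral_2_eq_2)
  have defect: "lin_op.transfer_defect c (F c N d \<theta>) S u z (mat_trace V) nu = 0"
    unfolding nu_def tr using assms(1,4,8,9,10) det_2_zero[OF assms(5,6)] by (intro defect) (auto simp: v_def)
  have summand: "?c i \<cdot>\<^sub>m (\<nu> z * op_prod n (map (\<lambda>j. \<nu> (u j)) (filter (\<lambda>j. j \<noteq> i) [1..<S + 1])))
      \<in> carrier_mat n n" for i
    by (rule smult_carrier_mat[OF mult_carrier_mat[OF \<nu>(1) prod(1)]])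
  show ?thesis
    unfolding n_def[symmetric]
  \<comment> \<open>Both sides are square matrices of the size of the chain, so their images in the
    ring type may be compared; there the equation is the vanishing of the defect.\<close>
  proof (rule block_op_inject[OF n])
    let ?R = "finsum (ring_mat TYPE(complex) n ())
      (\<lambda>i. ?c i \<cdot>\<^sub>m (\<nu> z * op_prod n (map (\<lambda>j. \<nu> (u j)) (filter (\<lambda>j. j \<noteq> i) [1..<S + 1])))) {1..S}"
    have R: "?R \<in> carrier_mat n n" "block_op n ?R = (\<Sum>i\<in>{1..S}. scale_lin_op (?c i)
        (nu z * prod_list (map (\<lambda>j. nu (u j)) (filter (\<lambda>j. j \<noteq> i) [1..<S + 1]))))"
      using block_op_finsum[OF n, of "{1..S}", OF _ summand]
      by (simp_all only: finite_atLeastAtMost block_op_smult[OF n mult_carrier_mat[OF \<nu>(1) prod(1)]]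
          block_op_mult[OF n \<nu>(1) prod(1)] \<nu>(2) prod(2))
    let ?L = "\<nu> z * op_prod n (map (\<lambda>j. \<nu> (u j)) [1..<S + 1])"
    show L: "?L \<in> carrier_mat n n"
      by (rule mult_carrier_mat[OF \<nu>(1) prod(1)])
    have P: "?r \<cdot>\<^sub>m op_prod n (map (\<lambda>j. \<nu> (u j)) [1..<S + 1]) \<in> carrier_mat n n"
      by (rule smult_carrier_mat[OF prod(1)])
    show "mat_trace V \<cdot>\<^sub>m (?r \<cdot>\<^sub>m op_prod n (map (\<lambda>j. \<nu> (u j)) [1..<S + 1]) + ?R) \<in> carrier_mat n n"
      by (rule smult_carrier_mat[OF add_carrier_mat[OF R(1)]])
    show "block_op n ?L = block_op n (mat_trace V \<cdot>\<^sub>m (?r \<cdot>\<^sub>m op_prod n (map (\<lambda>j. \<nu> (u j)) [1..<S + 1]) + ?R))"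
      unfolding block_op_mult[OF n \<nu>(1) prod(1)] block_op_smult[OF n add_carrier_mat[OF R(1)]]
        block_op_add[OF n P R(1)] block_op_smult[OF n prod(1)] R(2) \<nu>(2) prod(2)
      using defect unfolding lin_op.transfer_defect_def by (simp only: right_minus_eq)
  qed
qed

end
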